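(* Let $E$ and $F$ be real Banach spaces with unconditional Schauder bases $\mathcal{F}=((a_m,b_m^* ))_{m\in\mathbb{N}^*}$ and $\mathcal{G}=((x_n,y_n^* ))_{n\in\mathbb{N}^*}$, respectively. Let $\|\cdot\|^{Bess}_{E,\mathcal{F}}$ and $\|\cdot\|^{Bess}_{F,\mathcal{G}}$ be the associated Besselian norms, and $\alpha_{\mathcal{F},\mathcal{G}}^{Bess}$ the associated Besselian crossnorm. Then the spaces $(E,\|\cdot\|^{Bess}_{E,\mathcal{F}})$, $(F,\|\cdot\|^{Bess}_{F,\mathcal{G}})$ and $(E\otimes_{\alpha_{\mathcal{F},\mathcal{G}}^{Bess}}F,\ \alpha_{\mathcal{F},\mathcal{G}}^{Bess})$ are Banach lattices (i.e. each admits a partial order making it, with the indicated norm, a Banach lattice).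
   Context: $\mathbb{N}^*=\{1,2,3,\dots\}$; $E^*$ is the topological dual of $E$; $E\otimes F$ is the algebraic tensor product. A sequence of pairs $((a_m,b_m^* ))_m\subset E\times E^*$ is an unconditional Schauder basis (USB) for $E$ if every $x\in E$ has a unique expansion in scalar multiples of the $a_m$, this expansion is $x=\sum_m b_m^*(x)a_m$, and the series converges unconditionally for every $x$. The Besselian norm on $E$ is $\|x\|^{Bess}_{E,\mathcal{F}}:=\sup_{\|f^*\|_{E^*}\le1}\sum_{m=1}^\infty|b_m^*(x)f^*(a_m)|$, an equivalent norm on $E$; likewise $\|y\|^{Bess}_{F,\mathcal{G}}:=\sup_{\|g^*\|_{F^*}\le1}\sum_{n=1}^\infty|y_n^*(y)g^*(x_n)|$ on $F$. Besselian crossnorm: for a finite sum of elementary tensors put $$Bess\Big(\sum_{r=1}^R x^r\otimes y^r\Big):=\sup_{\|f^*\|_{E^*}\le 1,\ \|g^*\|_{F^*}\le 1}\ \sum_{r=1}^R\sum_{m,n=1}^\infty\left|b_m^*(x^r)\,y_n^*(y^r)\,f^*(a_m)\,g^*(x_n)\right|,$$ and for $u\in E\otimes F$ put $\alpha_{\mathcal{F},\mathcal{G}}^{Bess}(u):=\inf\{Bess(\sum_{r=1}^R x^r\otimes y^r): u=\sum_{r=1}^R x^r\otimes y^r\}$, the infimum over all finite representations of $u$. This is a norm; $E\otimes_{\alpha_{\mathcal{F},\mathcal{G}}^{Bess}}F$ is the completion of $E\otimes F$ for it, with the extended norm denoted by the same symbol. A Banach lattice is a real Banach space $L$ with a partial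 order $\preceq$ such that: (a) $x\preceq y$ implies $x+z\preceq y+z$ for all $z\in L$, and $\lambda x\preceq\lambda y$ for all scalars $\lambda\ge0$; (b) any $x,y\in L$ have a least upper bound $x\vee y$ and a greatest lower bound $x\wedge y$; (c) if $|x|\preceq|y|$ then $\|x\|_L\le\|y\|_L$, where $|x|=x\vee(-x)$. *)

theory Defs
  imports
    "HOL-Analysis.Analysis"
    "HOL-Library.Poly_Mapping"
    "HOL-Algebra.Module"
    "HOL-Algebra.Lattice"
begin

section \<open>Real Banach spaces and Banach lattices on a carrier\<close>

text \<open>The completion of \<open>E \<otimes> F\<close> depends on a norm that is itself built from two bases, so it cannot
  be a HOL type. Banach spaces and Banach lattices are therefore described on a carrier set, with
  vector spaces as modules over the ring of reals and lattices as in HOL-Algebra.\<close>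

definition real_ring :: "real ring" where
  "real_ring = \<lparr>carrier = UNIV, mult = (*), one = 1, zero = 0, add = (+)\<rparr>"

record 'v normed_module = "(real, 'v) module" +
  vnorm :: "'v \<Rightarrow> real"

text \<open>The \<open>mult\<close> and \<open>one\<close> fields inherited from the ring record play no role in a module.\<close>

locale real_normed_space =
  fixes V :: "('v, 'z) normed_module_scheme" (structure)
  assumes real_module: "module real_ring V"
    and vnorm_nonneg: "x \<in> carrier V \<Longrightarrow> 0 \<le> vnorm V x"
    and vnorm_eq_zero: "x \<in> carrier V \<Longrightarrow> vnorm V x = 0 \<longleftrightarrow> x = \<zero>"
    and vnorm_smult: "x \<in> carrier V \<Longrightarrow> vnorm V (c \<odot>\<^bsub>V\<^esub> x) = \<bar>c\<bar> * vnorm V x"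
    and vnorm_triangle: "x \<in> carrier V \<Longrightarrow> y \<in> carrier V \<Longrightarrow> vnorm V (x \<oplus> y) \<le> vnorm V x + vnorm V y"

locale real_banach_space = real_normed_space +
  assumes complete:
    "(\<And>n. s n \<in> carrier V) \<Longrightarrow>
     (\<And>e. 0 < e \<Longrightarrow> \<exists>M. \<forall>m\<ge>M. \<forall>n\<ge>M. vnorm V (s m \<ominus> s n) < e) \<Longrightarrow>
     \<exists>l\<in>carrier V. (\<lambda>n. vnorm V (s n \<ominus> l)) \<longlonglongrightarrow> 0"

definition order_on_carrier :: "('v, 'z) normed_module_scheme \<Rightarrow> ('v \<Rightarrow> 'v \<Rightarrow> bool) \<Rightarrow> 'v gorder" where
  "order_on_carrier V leq = \<lparr>carrier = carrier V, eq = (=), le = leq\<rparr>"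

definition labs :: "('v, 'z) normed_module_scheme \<Rightarrow> ('v \<Rightarrow> 'v \<Rightarrow> bool) \<Rightarrow> 'v \<Rightarrow> 'v" where
  "labs V leq x = x \<squnion>\<^bsub>order_on_carrier V leq\<^esub> (\<ominus>\<^bsub>V\<^esub> x)"

locale banach_lattice = real_banach_space V
  for V :: "('v, 'z) normed_module_scheme" (structure) +
  fixes leq :: "'v \<Rightarrow> 'v \<Rightarrow> bool" (infix \<open>\<preceq>\<close> 50)
  assumes is_lattice: "lattice (order_on_carrier V (\<preceq>))"
    and le_add_mono:
      "x \<in> carrier V \<Longrightarrow> y \<in> carrier V \<Longrightarrow> z \<in> carrier V \<Longrightarrow> x \<preceq> y \<Longrightarrow> x \<oplus> z \<preceq> y \<oplus> z"
    and le_smult_mono: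
      "x \<in> carrier V \<Longrightarrow> y \<in> carrier V \<Longrightarrow> 0 \<le> c \<Longrightarrow> x \<preceq> y \<Longrightarrow> c \<odot>\<^bsub>V\<^esub> x \<preceq> c \<odot>\<^bsub>V\<^esub> y"
    and vnorm_mono:
      "x \<in> carrier V \<Longrightarrow> y \<in> carrier V \<Longrightarrow> labs V (\<preceq>) x \<preceq> labs V (\<preceq>) y \<Longrightarrow> vnorm V x \<le> vnorm V y"

text \<open>A whole type, re-normed by \<open>N\<close>.\<close>

definition renormed :: "('v::real_vector \<Rightarrow> real) \<Rightarrow> 'v normed_module" where
  "renormed N =
     \<lparr>carrier = UNIV, mult = undefined, one = undefined, zero = 0, add = (+), smult = (*\<^sub>R), vnorm = N\<rparr>"


section \<open>Completion\<close>

text \<open>Cauchy sequences modulo null sequences.\<close>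

definition cauchy_seq :: "('v::real_vector \<Rightarrow> real) \<Rightarrow> (nat \<Rightarrow> 'v) \<Rightarrow> bool" where
  "cauchy_seq N s \<longleftrightarrow> (\<forall>e>0. \<exists>M. \<forall>m\<ge>M. \<forall>n\<ge>M. N (s m - s n) < e)"

definition cauchy_class :: "('v::real_vector \<Rightarrow> real) \<Rightarrow> (nat \<Rightarrow> 'v) \<Rightarrow> (nat \<Rightarrow> 'v) set" where
  "cauchy_class N s = {t. cauchy_seq N t \<and> (\<lambda>n. N (t n - s n)) \<longlonglongrightarrow> 0}"

definition cauchy_rep :: "(nat \<Rightarrow> 'v) set \<Rightarrow> nat \<Rightarrow> 'v" where
  "cauchy_rep P = (SOME s. s \<in> P)"

definition norm_completion :: "('v::real_vector \<Rightarrow> real) \<Rightarrow> (nat \<Rightarrow> 'v) set normed_module" where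
  "norm_completion N =
     \<lparr>carrier = cauchy_class N ` {s. cauchy_seq N s},
      mult = undefined,
      one = undefined,
      zero = cauchy_class N (\<lambda>n. 0),
      add = (\<lambda>P Q. cauchy_class N (\<lambda>n. cauchy_rep P n + cauchy_rep Q n)),
      smult = (\<lambda>c P. cauchy_class N (\<lambda>n. c *\<^sub>R cauchy_rep P n)),
      vnorm = (\<lambda>P. lim (\<lambda>n. N (cauchy_rep P n)))\<rparr>"


section \<open>Algebraic tensor product\<close>

text \<open>The free real vector space on \<open>'a \<times> 'b\<close>, modulo the span of the bilinearity relations.\<close>

instantiation poly_mapping :: (type, real_vector) real_vector
begin

lift_definition scaleR_poly_mapping :: "real \<Rightarrow> ('a \<Rightarrow>\<^sub>0 'b) \<Rightarrow> 'a \<Rightarrow>\<^sub>0 'b"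
  is "\<lambda>c f k. c *\<^sub>R f k"
  by (erule rev_finite_subset) auto

instance
  by standard (transfer; simp add: fun_eq_iff scaleR_add_right scaleR_add_left)+

end

definition free_elem :: "'a \<Rightarrow> 'b \<Rightarrow> ('a \<times> 'b) \<Rightarrow>\<^sub>0 real" where
  "free_elem x y = Poly_Mapping.single (x, y) 1"

definition bilinearity_relations :: "(('a::real_vector \<times> 'b::real_vector) \<Rightarrow>\<^sub>0 real) set" where
  "bilinearity_relations =
     {free_elem (x + x') y - free_elem x y - free_elem x' y | x x' y. True} \<union>
     {free_elem x (y + y') - free_elem x y - free_elem x y' | x y y'. True} \<union>
     {free_elem (c *\<^sub>R x) y - c *\<^sub>R free_elem x y | c x y. True} \<union>
     {free_elem x (c *\<^sub>R y) - c *\<^sub>R free_elem x y | c x y. True}"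

quotient_type (overloaded) ('a, 'b) tensor_product =
    "('a::real_vector \<times> 'b::real_vector) \<Rightarrow>\<^sub>0 real" /
    "\<lambda>p q. p - q \<in> span bilinearity_relations"
proof (rule equivpI)
  show "reflp (\<lambda>p q. p - q \<in> span (bilinearity_relations :: (('a \<times> 'b) \<Rightarrow>\<^sub>0 real) set))"
    by (simp add: reflp_def span_zero)
  show "symp (\<lambda>p q. p - q \<in> span (bilinearity_relations :: (('a \<times> 'b) \<Rightarrow>\<^sub>0 real) set))"
    by (rule sympI) (metis minus_diff_eq span_neg)
  show "transp (\<lambda>p q. p - q \<in> span (bilinearity_relations :: (('a \<times> 'b) \<Rightarrow>\<^sub>0 real) set))"
  proof (rule transpI)
    fix p q r :: "('a \<times> 'b) \<Rightarrow>\<^sub>0 real"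
    assume "p - q \<in> span bilinearity_relations" "q - r \<in> span bilinearity_relations"
    then have "(p - q) + (q - r) \<in> span bilinearity_relations"
      by (rule span_add)
    then show "p - r \<in> span bilinearity_relations"
      by simp
  qed
qed

instantiation tensor_product :: (real_vector, real_vector) real_vector
begin

lift_definition zero_tensor_product :: "('a, 'b) tensor_product" is 0 .

lift_definition plus_tensor_product ::
  "('a, 'b) tensor_product \<Rightarrow> ('a, 'b) tensor_product \<Rightarrow> ('a, 'b) tensor_product" is "(+)"
  by (simp add: add_diff_add span_add)

lift_definition minus_tensor_product ::
  "('a, 'b) tensor_product \<Rightarrow> ('a, 'b) tensor_product \<Rightarrow> ('a, 'b) tensor_product" is "(-)"
proof -
  fix p p' q q' :: "('a \<times> 'b) \<Rightarrow>\<^sub>0 real"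
  assume "p - p' \<in> span bilinearity_relations" "q - q' \<in> span bilinearity_relations"
  then have "(p - p') - (q - q') \<in> span bilinearity_relations"
    by (rule span_diff)
  also have "(p - p') - (q - q') = (p - q) - (p' - q')"
    by simp
  finally show "(p - q) - (p' - q') \<in> span bilinearity_relations" .
qed

lift_definition uminus_tensor_product :: "('a, 'b) tensor_product \<Rightarrow> ('a, 'b) tensor_product"
  is uminus
  by (subst minus_diff_minus) (rule span_neg)

lift_definition scaleR_tensor_product ::
  "real \<Rightarrow> ('a, 'b) tensor_product \<Rightarrow> ('a, 'b) tensor_product" is "(*\<^sub>R)"
  by (subst scaleR_diff_right[symmetric]) (rule span_scale)

instance
  by standard
    (transfer; simp add: add.assoc add.commute scaleR_add_right scaleR_add_left span_zero)+

end

lift_definition tensor :: "'a::real_vector \<Rightarrow> 'b::real_vector \<Rightarrow> ('a, 'b) tensor_product"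
  is free_elem .

lemma tensor_add_left: "tensor (x + x') y = tensor x y + tensor x' y"
  by transfer
    (unfold diff_diff_eq[symmetric], rule span_base, unfold bilinearity_relations_def, blast)

lemma tensor_add_right: "tensor x (y + y') = tensor x y + tensor x y'"
  by transfer
    (unfold diff_diff_eq[symmetric], rule span_base, unfold bilinearity_relations_def, blast)

lemma tensor_scaleR_left: "tensor (c *\<^sub>R x) y = c *\<^sub>R tensor x y"
  by transfer (rule span_base, unfold bilinearity_relations_def, blast)

lemma tensor_scaleR_right: "tensor x (c *\<^sub>R y) = c *\<^sub>R tensor x y"
  by transfer (rule span_base, unfold bilinearity_relations_def, blast)


section \<open>Unconditional Schauder bases and Besselian norms\<close>

text \<open>Sequences are indexed from \<open>0\<close>.\<close>

definition unconditional_schauder_basis ::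
    "(nat \<Rightarrow> 'a::banach) \<Rightarrow> (nat \<Rightarrow> 'a \<Rightarrow>\<^sub>L real) \<Rightarrow> bool" where
  "unconditional_schauder_basis a b \<longleftrightarrow>
     (\<forall>x. (\<exists>!c. (\<lambda>m. c m *\<^sub>R a m) sums x) \<and>
          (\<lambda>m. b m x *\<^sub>R a m) sums x \<and>
          (\<forall>\<pi>. bij \<pi> \<longrightarrow> summable (\<lambda>m. b (\<pi> m) x *\<^sub>R a (\<pi> m))))"

text \<open>Suprema and series of nonnegative terms are taken in \<^typ>\<open>ennreal\<close>, where they always exist.\<close>

definition bess_norm ::
    "(nat \<Rightarrow> 'a::real_normed_vector) \<Rightarrow> (nat \<Rightarrow> 'a \<Rightarrow>\<^sub>L real) \<Rightarrow> 'a \<Rightarrow> real" where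
  "bess_norm a b x =
     enn2real (SUP f\<in>{f :: 'a \<Rightarrow>\<^sub>L real. norm f \<le> 1}. suminf (\<lambda>m. ennreal \<bar>b m x * blinfun_apply f (a m)\<bar>))"

definition bess ::
    "(nat \<Rightarrow> 'a::real_normed_vector) \<Rightarrow> (nat \<Rightarrow> 'a \<Rightarrow>\<^sub>L real) \<Rightarrow>
     (nat \<Rightarrow> 'b::real_normed_vector) \<Rightarrow> (nat \<Rightarrow> 'b \<Rightarrow>\<^sub>L real) \<Rightarrow> ('a \<times> 'b) list \<Rightarrow> ennreal" where
  "bess a b x y ts =
     (SUP (f, g) \<in> {f :: 'a \<Rightarrow>\<^sub>L real. norm f \<le> 1} \<times> {g :: 'b \<Rightarrow>\<^sub>L real. norm g \<le> 1}.
        \<Sum>(v, w)\<leftarrow>ts. suminf (\<lambda>m. suminf (\<lambda>n.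
          ennreal \<bar>b m v * y n w * blinfun_apply f (a m) * blinfun_apply g (x n)\<bar>)))"

definition bess_crossnorm ::
    "(nat \<Rightarrow> 'a::real_normed_vector) \<Rightarrow> (nat \<Rightarrow> 'a \<Rightarrow>\<^sub>L real) \<Rightarrow>
     (nat \<Rightarrow> 'b::real_normed_vector) \<Rightarrow> (nat \<Rightarrow> 'b \<Rightarrow>\<^sub>L real) \<Rightarrow> ('a, 'b) tensor_product \<Rightarrow> real" where
  "bess_crossnorm a b x y u =
     enn2real (INF ts\<in>{ts. u = (\<Sum>(v, w)\<leftarrow>ts. tensor v w)}. bess a b x y ts)"

end

theory Submission
  imports Defs
begin

text \<open>The three spaces are all instances of one construction. Given a family \<open>W\<close> of nonnegative weights
  on an index type, let \<open>wnorm W d\<close> be the supremum over \<open>w \<in> W\<close> of the weighted sums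
  \<open>\<Sum>i. w i * \<bar>d i\<bar>\<close>, and let \<open>wspace W\<close> be the closure of the finitely supported functions for
  this norm. The norm depends on \<open>\<bar>d\<bar>\<close> only and monotonically, and it is lower semicontinuous for
  coordinatewise convergence; hence \<open>wspace W\<close> is complete and, with the coordinatewise order, a
  Banach lattice (\<open>banach_lattice_transport\<close>).

  For a basis \<open>(a, b)\<close> take the weights \<open>m \<mapsto> \<bar>f (a m)\<bar>\<close> with \<open>f\<close> in the dual unit ball. Then the
  Besselian norm of \<open>v\<close> is the weighted norm of its coordinate sequence, and \<open>v \<mapsto> coords v\<close> is onto
  \<open>wspace\<close>. Coordinate sequences have small tails because an unconditionally convergent series has
  uniformly small finite sums far out (\<open>unconditional_tail\<close>), which splitting by signs turns into
  small absolute sums, uniformly in \<open>f\<close>. Conversely, by the Hahn--Banach theorem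
  (\<open>norming_functional\<close>) a sequence in \<open>wspace\<close> gives a convergent series.

  For the tensor product take the weights \<open>(m, n) \<mapsto> \<bar>f (a m)\<bar> * \<bar>g (x n)\<bar>\<close>. The Besselian crossnorm
  of \<open>u\<close> equals the weighted norm of its coefficient matrix (\<open>bess_crossnorm_eq\<close>). It is at least
  that norm by the triangle inequality. Equality holds on the span of the basis tensors, where the
  expansion itself is an optimal representation, and this span is dense for the crossnorm. Since
  every finitely supported matrix occurs, the completion is isometric to \<open>wspace\<close> of these weights
  (\<open>banach_lattice_norm_completion\<close>).\<close>

section \<open>Weighted supremum norms\<close>

text \<open>The supremum over a family \<open>W\<close> of weights of the weighted \<open>\<ell>\<^sup>1\<close> norms of \<open>d\<close>. Each
  weighted norm is a supremum of finite partial sums, so that no ordering of the index type is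
  involved, and the value may be \<open>\<infinity>\<close>.\<close>
definition wnorm :: "('i \<Rightarrow> real) set \<Rightarrow> ('i \<Rightarrow> real) \<Rightarrow> ennreal" where
  "wnorm W d = (SUP (w, F) \<in> W \<times> {F. finite F}. ennreal (\<Sum>i\<in>F. w i * \<bar>d i\<bar>))"

text \<open>The closure of the finitely supported functions for \<^const>\<open>wnorm\<close>, described by the tails
  that remain when the coordinates in a finite set are deleted.\<close>
definition wspace :: "('i \<Rightarrow> real) set \<Rightarrow> ('i \<Rightarrow> real) set" where
  "wspace W = {d. \<forall>\<epsilon>>0. \<exists>F. finite F \<and> wnorm W (\<lambda>i. if i \<in> F then 0 else d i) \<le> ennreal \<epsilon>}"

text \<open>The real-valued norm; it is meaningful on \<^const>\<open>wspace\<close>, where \<^const>\<open>wnorm\<close> is finite.\<close>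
definition wnorm_real :: "('i \<Rightarrow> real) set \<Rightarrow> ('i \<Rightarrow> real) \<Rightarrow> real" where
  "wnorm_real W d = enn2real (wnorm W d)"

lemma wnorm_le_iff:
  "wnorm W d \<le> C \<longleftrightarrow> (\<forall>w\<in>W. \<forall>F. finite F \<longrightarrow> ennreal (\<Sum>i\<in>F. w i * \<bar>d i\<bar>) \<le> C)"
  unfolding wnorm_def by (auto simp: SUP_le_iff)

lemma wnorm_leI:
  assumes "\<And>w F. w \<in> W \<Longrightarrow> finite F \<Longrightarrow> ennreal (\<Sum>i\<in>F. w i * \<bar>d i\<bar>) \<le> C"
  shows "wnorm W d \<le> C"
  using assms by (simp add: wnorm_le_iff)

lemma sum_le_wnorm:
  assumes "w \<in> W" "finite F"
  shows "ennreal (\<Sum>i\<in>F. w i * \<bar>d i\<bar>) \<le> wnorm W d"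
  using assms wnorm_le_iff[of W d "wnorm W d"] by simp

lemma wspaceD:
  assumes "d \<in> wspace W" "0 < \<epsilon>"
  obtains F where "finite F" "wnorm W (\<lambda>i. if i \<in> F then 0 else d i) \<le> ennreal \<epsilon>"
  using assms unfolding wspace_def by blast

locale nonneg_weights =
  fixes W :: "('i \<Rightarrow> real) set"
  assumes nonneg: "w \<in> W \<Longrightarrow> 0 \<le> w i"
begin

lemma weighted_sum_nonneg: "w \<in> W \<Longrightarrow> 0 \<le> (\<Sum>i\<in>F. w i * \<bar>d i\<bar>)"
  by (simp add: sum_nonneg nonneg)

lemma wnorm_mono:
  assumes "\<And>i. \<bar>d i\<bar> \<le> \<bar>e i\<bar>"
  shows "wnorm W d \<le> wnorm W e"
proof (rule wnorm_leI)
  fix w and F :: "'i set" assume w: "w \<in> W" "finite F"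
  have "(\<Sum>i\<in>F. w i * \<bar>d i\<bar>) \<le> (\<Sum>i\<in>F. w i * \<bar>e i\<bar>)"
    by (intro sum_mono mult_left_mono assms nonneg w)
  then show "ennreal (\<Sum>i\<in>F. w i * \<bar>d i\<bar>) \<le> wnorm W e"
    using sum_le_wnorm[OF w, of e] by (meson ennreal_leI order_trans)
qed

lemma wnorm_add: "wnorm W (\<lambda>i. d i + e i) \<le> wnorm W d + wnorm W e"
proof (rule wnorm_leI)
  fix w and F :: "'i set" assume w: "w \<in> W" "finite F"
  have "(\<Sum>i\<in>F. w i * \<bar>d i + e i\<bar>) \<le> (\<Sum>i\<in>F. w i * \<bar>d i\<bar> + w i * \<bar>e i\<bar>)"
    unfolding distrib_left[symmetric] by (intro sum_mono mult_left_mono nonneg w) simp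
  then have "ennreal (\<Sum>i\<in>F. w i * \<bar>d i + e i\<bar>)
      \<le> ennreal (\<Sum>i\<in>F. w i * \<bar>d i\<bar>) + ennreal (\<Sum>i\<in>F. w i * \<bar>e i\<bar>)"
    by (subst ennreal_plus[symmetric])
      (auto simp: sum.distrib intro: ennreal_leI weighted_sum_nonneg[OF w(1)])
  also have "\<dots> \<le> wnorm W d + wnorm W e"
    by (intro add_mono sum_le_wnorm w)
  finally show "ennreal (\<Sum>i\<in>F. w i * \<bar>d i + e i\<bar>) \<le> wnorm W d + wnorm W e" .
qed

lemma wnorm_zero [simp]: "wnorm W (\<lambda>i. 0) = 0"
  using wnorm_leI[of W "\<lambda>i. 0" 0] by simp

lemma wnorm_scale: "wnorm W (\<lambda>i. c * d i) = ennreal \<bar>c\<bar> * wnorm W d"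
proof -
  have le: "wnorm W (\<lambda>i. c * d i) \<le> ennreal \<bar>c\<bar> * wnorm W d" for c d
  proof (rule wnorm_leI)
    fix w and F :: "'i set" assume w: "w \<in> W" "finite F"
    have "(\<Sum>i\<in>F. w i * \<bar>c * d i\<bar>) = \<bar>c\<bar> * (\<Sum>i\<in>F. w i * \<bar>d i\<bar>)"
      by (simp add: sum_distrib_left abs_mult algebra_simps)
    then show "ennreal (\<Sum>i\<in>F. w i * \<bar>c * d i\<bar>) \<le> ennreal \<bar>c\<bar> * wnorm W d"
      using sum_le_wnorm[OF w, of d] by (simp add: ennreal_mult' mult_left_mono)
  qed
  show ?thesis
  proof (cases "c = 0")
    case False
    have "ennreal \<bar>c\<bar> * wnorm W d = ennreal \<bar>c\<bar> * wnorm W (\<lambda>i. inverse c * (c * d i))"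
      using False by (simp add: mult.assoc[symmetric])
    also have "\<dots> \<le> ennreal \<bar>c\<bar> * (ennreal \<bar>inverse c\<bar> * wnorm W (\<lambda>i. c * d i))"
      by (intro mult_left_mono le) simp
    also have "\<dots> = wnorm W (\<lambda>i. c * d i)"
      using False by (simp add: mult.assoc[symmetric] ennreal_mult'[symmetric] abs_mult[symmetric])
    finally show ?thesis using le[of c d] by (rule antisym[rotated])
  qed simp
qed

lemma wnorm_diff: "wnorm W (\<lambda>i. d i - e i) \<le> wnorm W d + wnorm W e"
  using wnorm_add[of d "\<lambda>i. (-1) * e i"] wnorm_scale[of "-1" e] by simp

lemma wnorm_uminus: "wnorm W (\<lambda>i. - d i) = wnorm W d"
  using wnorm_scale[of "-1" d] by simp

end

text \<open>Boundedness at each index makes finitely supported functions have finite norm; positivity at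
  each index makes the coordinates continuous, hence the norm definite.\<close>
locale weight_family = nonneg_weights W for W :: "('i \<Rightarrow> real) set" +
  assumes bounded: "\<exists>C. \<forall>w\<in>W. w i \<le> C"
    and positive: "\<exists>w\<in>W. 0 < w i"
begin

lemma wnorm_finite_support:
  assumes "finite F" "\<And>i. i \<notin> F \<Longrightarrow> d i = 0"
  shows "wnorm W d < \<infinity>"
proof -
  obtain C where C: "\<And>i w. w \<in> W \<Longrightarrow> w i \<le> C i"
    using bounded by metis
  have "wnorm W d \<le> ennreal (\<Sum>i\<in>F. C i * \<bar>d i\<bar>)"
  proof (intro wnorm_leI ennreal_leI)
    fix w and G :: "'i set" assume w: "w \<in> W" "finite G"
    have "(\<Sum>i\<in>G. w i * \<bar>d i\<bar>) = (\<Sum>i\<in>G\<inter>F. w i * \<bar>d i\<bar>)"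
      using w assms(2) by (intro sum.mono_neutral_right) auto
    also have "\<dots> \<le> (\<Sum>i\<in>F. w i * \<bar>d i\<bar>)"
      by (intro sum_mono2 assms) (auto simp: nonneg[OF w(1)])
    also have "\<dots> \<le> (\<Sum>i\<in>F. C i * \<bar>d i\<bar>)"
      by (intro sum_mono mult_right_mono C w) auto
    finally show "(\<Sum>i\<in>G. w i * \<bar>d i\<bar>) \<le> (\<Sum>i\<in>F. C i * \<bar>d i\<bar>)" .
  qed
  then show ?thesis by (rule le_less_trans) simp
qed

lemma coordinate_bound: "\<exists>C>0. \<forall>d. ennreal (C * \<bar>d i\<bar>) \<le> wnorm W d"
proof -
  obtain w where w: "w \<in> W" "0 < w i" using positive by blast
  then have "ennreal (w i * \<bar>d i\<bar>) \<le> wnorm W d" for d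
    using sum_le_wnorm[of w W "{i}" d] by simp
  with w show ?thesis by blast
qed

text \<open>Fatou's lemma: the norm is lower semicontinuous for coordinatewise convergence, because it is a
  supremum of finite sums.\<close>
lemma wnorm_lim_le:
  assumes "\<And>i. (\<lambda>k. d k i) \<longlonglongrightarrow> e i"
    and "eventually (\<lambda>k. wnorm W (d k) \<le> C) sequentially"
  shows "wnorm W e \<le> C"
proof (rule wnorm_leI)
  fix w and F :: "'i set" assume w: "w \<in> W" "finite F"
  have "(\<lambda>k. ennreal (\<Sum>i\<in>F. w i * \<bar>d k i\<bar>)) \<longlonglongrightarrow> ennreal (\<Sum>i\<in>F. w i * \<bar>e i\<bar>)"
    by (intro tendsto_ennrealI tendsto_sum tendsto_mult tendsto_rabs tendsto_const assms)
  moreover have "eventually (\<lambda>k. ennreal (\<Sum>i\<in>F. w i * \<bar>d k i\<bar>) \<le> C) sequentially"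
    using assms(2) by eventually_elim (use sum_le_wnorm[OF w] order_trans in blast)
  ultimately show "ennreal (\<Sum>i\<in>F. w i * \<bar>e i\<bar>) \<le> C"
    by (rule tendsto_upperbound) simp
qed

lemma wspace_finite_support:
  assumes "finite F" "\<And>i. i \<notin> F \<Longrightarrow> d i = 0"
  shows "d \<in> wspace W"
proof -
  have "(\<lambda>i. if i \<in> F then 0 else d i) = (\<lambda>i. 0)" using assms by auto
  then show ?thesis unfolding wspace_def using assms(1) by (auto intro!: exI[of _ F])
qed

lemma wspace_zero: "(\<lambda>i. 0) \<in> wspace W"
  by (rule wspace_finite_support[of "{}"]) auto

text \<open>Tails are monotone in \<open>\<bar>h\<bar>\<close> and subadditive, so that this single domination principle makes
  the space solid and closed under sums, maxima and minima.\<close>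
lemma wspace_solid_add:
  assumes "d \<in> wspace W" "e \<in> wspace W" "\<And>i. \<bar>h i\<bar> \<le> \<bar>d i\<bar> + \<bar>e i\<bar>"
  shows "h \<in> wspace W"
  unfolding wspace_def
proof (intro CollectI allI impI)
  fix \<epsilon> :: real assume "0 < \<epsilon>"
  then have "0 < \<epsilon>/2" by simp
  then obtain F G where F: "finite F" "wnorm W (\<lambda>i. if i \<in> F then 0 else d i) \<le> ennreal (\<epsilon>/2)"
    and G: "finite G" "wnorm W (\<lambda>i. if i \<in> G then 0 else e i) \<le> ennreal (\<epsilon>/2)"
    by (metis wspaceD assms(1,2))
  have "wnorm W (\<lambda>i. if i \<in> F \<union> G then 0 else h i)
      \<le> wnorm W (\<lambda>i. \<bar>if i \<in> F then 0 else d i\<bar> + \<bar>if i \<in> G then 0 else e i\<bar>)"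
    using assms(3) by (intro wnorm_mono) auto
  also have "\<dots> \<le> wnorm W (\<lambda>i. \<bar>if i \<in> F then 0 else d i\<bar>) + wnorm W (\<lambda>i. \<bar>if i \<in> G then 0 else e i\<bar>)"
    by (rule wnorm_add)
  also have "\<dots> \<le> wnorm W (\<lambda>i. if i \<in> F then 0 else d i) + wnorm W (\<lambda>i. if i \<in> G then 0 else e i)"
    by (intro add_mono wnorm_mono) auto
  also have "\<dots> \<le> ennreal (\<epsilon>/2) + ennreal (\<epsilon>/2)"
    by (intro add_mono F G)
  also have "\<dots> = ennreal \<epsilon>"
    using \<open>0 < \<epsilon>\<close> by (subst ennreal_plus[symmetric]) auto
  finally show "\<exists>F. finite F \<and> wnorm W (\<lambda>i. if i \<in> F then 0 else h i) \<le> ennreal \<epsilon>"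
    using F(1) G(1) by (intro exI[of _ "F \<union> G"]) auto
qed

lemma wspace_add: "d \<in> wspace W \<Longrightarrow> e \<in> wspace W \<Longrightarrow> (\<lambda>i. d i + e i) \<in> wspace W"
  by (erule wspace_solid_add, assumption) simp

lemma wspace_diff: "d \<in> wspace W \<Longrightarrow> e \<in> wspace W \<Longrightarrow> (\<lambda>i. d i - e i) \<in> wspace W"
  by (erule wspace_solid_add, assumption) simp

lemma wspace_max: "d \<in> wspace W \<Longrightarrow> e \<in> wspace W \<Longrightarrow> (\<lambda>i. max (d i) (e i)) \<in> wspace W"
  by (erule wspace_solid_add, assumption) auto

lemma wspace_min: "d \<in> wspace W \<Longrightarrow> e \<in> wspace W \<Longrightarrow> (\<lambda>i. min (d i) (e i)) \<in> wspace W"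
  by (erule wspace_solid_add, assumption) auto

lemma wspace_scale:
  assumes "d \<in> wspace W"
  shows "(\<lambda>i. c * d i) \<in> wspace W"
proof (cases "c = 0")
  case False
  show ?thesis
    unfolding wspace_def
  proof (intro CollectI allI impI)
    fix \<epsilon> :: real assume "0 < \<epsilon>"
    then have "0 < \<epsilon>/\<bar>c\<bar>" using False by simp
    then obtain F where F: "finite F" "wnorm W (\<lambda>i. if i \<in> F then 0 else d i) \<le> ennreal (\<epsilon>/\<bar>c\<bar>)"
      by (metis wspaceD assms)
    have "wnorm W (\<lambda>i. if i \<in> F then 0 else c * d i) = wnorm W (\<lambda>i. c * (if i \<in> F then 0 else d i))"
      by (rule arg_cong[of _ _ "wnorm W"]) auto
    also have "\<dots> \<le> ennreal \<bar>c\<bar> * ennreal (\<epsilon>/\<bar>c\<bar>)"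
      unfolding wnorm_scale by (intro mult_left_mono F) simp
    also have "\<dots> = ennreal \<epsilon>"
      using False by (simp add: ennreal_mult'[symmetric])
    finally show "\<exists>F. finite F \<and> wnorm W (\<lambda>i. if i \<in> F then 0 else c * d i) \<le> ennreal \<epsilon>"
      using F(1) by blast
  qed
qed (simp add: wspace_zero)

lemma wspace_closed:
  assumes "\<And>\<epsilon>. 0 < \<epsilon> \<Longrightarrow> \<exists>e\<in>wspace W. wnorm W (\<lambda>i. d i - e i) \<le> ennreal \<epsilon>"
  shows "d \<in> wspace W"
  unfolding wspace_def
proof (intro CollectI allI impI)
  fix \<epsilon> :: real assume "0 < \<epsilon>"
  then have "0 < \<epsilon>/2" by simp
  then obtain e where e: "e \<in> wspace W" "wnorm W (\<lambda>i. d i - e i) \<le> ennreal (\<epsilon>/2)"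
    using assms by blast
  obtain F where F: "finite F" "wnorm W (\<lambda>i. if i \<in> F then 0 else e i) \<le> ennreal (\<epsilon>/2)"
    by (rule wspaceD[OF e(1) \<open>0 < \<epsilon>/2\<close>])
  have "wnorm W (\<lambda>i. if i \<in> F then 0 else d i)
      = wnorm W (\<lambda>i. (if i \<in> F then 0 else d i - e i) + (if i \<in> F then 0 else e i))"
    by (rule arg_cong[of _ _ "wnorm W"]) auto
  also have "\<dots> \<le> wnorm W (\<lambda>i. if i \<in> F then 0 else d i - e i) + wnorm W (\<lambda>i. if i \<in> F then 0 else e i)"
    by (rule wnorm_add)
  also have "\<dots> \<le> wnorm W (\<lambda>i. d i - e i) + wnorm W (\<lambda>i. if i \<in> F then 0 else e i)"
    by (intro add_mono wnorm_mono) auto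
  also have "\<dots> \<le> ennreal (\<epsilon>/2) + ennreal (\<epsilon>/2)"
    by (intro add_mono e F)
  also have "\<dots> = ennreal \<epsilon>"
    using \<open>0 < \<epsilon>\<close> by (subst ennreal_plus[symmetric]) auto
  finally show "\<exists>F. finite F \<and> wnorm W (\<lambda>i. if i \<in> F then 0 else d i) \<le> ennreal \<epsilon>"
    using F(1) by blast
qed

lemma wnorm_wspace_finite:
  assumes "d \<in> wspace W"
  shows "wnorm W d < \<infinity>"
proof -
  obtain F where F: "finite F" "wnorm W (\<lambda>i. if i \<in> F then 0 else d i) \<le> ennreal 1"
    by (rule wspaceD[OF assms zero_less_one])
  have "wnorm W d = wnorm W (\<lambda>i. (if i \<in> F then d i else 0) + (if i \<in> F then 0 else d i))"
    by (rule arg_cong[of _ _ "wnorm W"]) auto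
  also have "\<dots> \<le> wnorm W (\<lambda>i. if i \<in> F then d i else 0) + wnorm W (\<lambda>i. if i \<in> F then 0 else d i)"
    by (rule wnorm_add)
  also have "\<dots> < \<infinity>"
    using wnorm_finite_support[OF F(1), of "\<lambda>i. if i \<in> F then d i else 0"] F(2)
    by (auto simp: ennreal_add_less_top intro: le_less_trans)
  finally show ?thesis .
qed

lemma ennreal_wnorm_real: "d \<in> wspace W \<Longrightarrow> ennreal (wnorm_real W d) = wnorm W d"
  unfolding wnorm_real_def using wnorm_wspace_finite[of d] by simp

lemma wnorm_real_nonneg: "0 \<le> wnorm_real W d"
  by (simp add: wnorm_real_def)

lemma wnorm_real_le:
  "wnorm W d \<le> ennreal C \<Longrightarrow> 0 \<le> C \<Longrightarrow> wnorm_real W d \<le> C"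
  unfolding wnorm_real_def by (metis enn2real_ennreal enn2real_mono ennreal_less_top)

lemma wnorm_real_add:
  assumes "d \<in> wspace W" "e \<in> wspace W"
  shows "wnorm_real W (\<lambda>i. d i + e i) \<le> wnorm_real W d + wnorm_real W e"
  using wnorm_add[of d e] assms
  by (intro wnorm_real_le) (simp_all add: ennreal_wnorm_real wnorm_real_nonneg)

lemma wnorm_real_scale: "wnorm_real W (\<lambda>i. c * d i) = \<bar>c\<bar> * wnorm_real W d"
  unfolding wnorm_real_def by (simp add: wnorm_scale enn2real_mult)

lemma wnorm_real_mono:
  assumes "e \<in> wspace W" "\<And>i. \<bar>d i\<bar> \<le> \<bar>e i\<bar>"
  shows "wnorm_real W d \<le> wnorm_real W e"
  unfolding wnorm_real_def
  using wnorm_wspace_finite[OF assms(1)] by (intro enn2real_mono wnorm_mono assms(2)) simp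

lemma coordinate_bound_real: "\<exists>C>0. \<forall>d\<in>wspace W. C * \<bar>d i\<bar> \<le> wnorm_real W d"
proof -
  obtain C where C: "C > 0" "\<And>d. ennreal (C * \<bar>d i\<bar>) \<le> wnorm W d"
    using coordinate_bound by blast
  have "C * \<bar>d i\<bar> \<le> wnorm_real W d" if "d \<in> wspace W" for d
    using C(2)[of d] by (simp add: ennreal_wnorm_real[OF that, symmetric] wnorm_real_nonneg)
  with C(1) show ?thesis by blast
qed

lemma wnorm_real_eq_0_iff:
  assumes "d \<in> wspace W"
  shows "wnorm_real W d = 0 \<longleftrightarrow> d = (\<lambda>i. 0)"
proof
  assume z: "wnorm_real W d = 0"
  show "d = (\<lambda>i. 0)"
  proof
    fix i
    obtain C where "C > 0" "C * \<bar>d i\<bar> \<le> wnorm_real W d"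
      using coordinate_bound_real assms by blast
    with z show "d i = 0" by (simp add: mult_le_0_iff)
  qed
qed (simp add: wnorm_real_def)

lemma wnorm_real_minus_commute: "wnorm_real W (\<lambda>i. d i - e i) = wnorm_real W (\<lambda>i. e i - d i)"
  using wnorm_real_scale[of "-1" "\<lambda>i. d i - e i"] by simp

text \<open>The coordinatewise limit of a Cauchy sequence is its limit in norm, by lower semicontinuity.\<close>
lemma wspace_complete:
  assumes d: "\<And>k. d k \<in> wspace W"
    and Cauchy: "\<And>\<epsilon>. 0 < \<epsilon> \<Longrightarrow> \<exists>M. \<forall>m\<ge>M. \<forall>n\<ge>M. wnorm_real W (\<lambda>i. d m i - d n i) < \<epsilon>"
  shows "\<exists>e\<in>wspace W. (\<lambda>k. wnorm_real W (\<lambda>i. d k i - e i)) \<longlonglongrightarrow> 0"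
proof -
  have "convergent (\<lambda>k. d k i)" for i
    unfolding Cauchy_convergent_iff[symmetric]
  proof (rule metric_CauchyI)
    fix \<epsilon> :: real assume "0 < \<epsilon>"
    obtain C where C: "C > 0" "\<And>d. d \<in> wspace W \<Longrightarrow> C * \<bar>d i\<bar> \<le> wnorm_real W d"
      using coordinate_bound_real by blast
    obtain M where M: "\<And>m n. m \<ge> M \<Longrightarrow> n \<ge> M \<Longrightarrow> wnorm_real W (\<lambda>i. d m i - d n i) < C * \<epsilon>"
      using Cauchy[of "C * \<epsilon>"] C \<open>0 < \<epsilon>\<close> by auto
    show "\<exists>M. \<forall>m\<ge>M. \<forall>n\<ge>M. dist (d m i) (d n i) < \<epsilon>"
    proof (intro exI allI impI)
      fix m n assume "m \<ge> M" "n \<ge> M"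
      then have "C * \<bar>d m i - d n i\<bar> < C * \<epsilon>"
        using C(2)[OF wspace_diff[OF d d], of m n] M[of m n] by simp
      then show "dist (d m i) (d n i) < \<epsilon>" using C by (simp add: dist_real_def)
    qed
  qed
  then obtain e where e: "\<And>i. (\<lambda>k. d k i) \<longlonglongrightarrow> e i"
    unfolding convergent_def by metis
  have tail: "\<exists>M. \<forall>m\<ge>M. wnorm W (\<lambda>i. d m i - e i) \<le> ennreal \<epsilon>" if "0 < \<epsilon>" for \<epsilon>
  proof -
    obtain M where M: "\<And>m n. m \<ge> M \<Longrightarrow> n \<ge> M \<Longrightarrow> wnorm_real W (\<lambda>i. d m i - d n i) < \<epsilon>"
      using Cauchy[OF \<open>0 < \<epsilon>\<close>] by auto
    have "wnorm W (\<lambda>i. d m i - e i) \<le> ennreal \<epsilon>" if "m \<ge> M" for m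
    proof (rule wnorm_lim_le)
      show "(\<lambda>k. d m i - d k i) \<longlonglongrightarrow> d m i - e i" for i
        by (intro tendsto_diff tendsto_const e)
      show "eventually (\<lambda>k. wnorm W (\<lambda>i. d m i - d k i) \<le> ennreal \<epsilon>) sequentially"
        using eventually_ge_at_top[of M]
      proof eventually_elim
        case (elim k)
        then show ?case using M[OF that elim]
          by (simp add: ennreal_wnorm_real[OF wspace_diff[OF d d], symmetric] ennreal_leI)
      qed
    qed
    then show ?thesis by blast
  qed
  have "e \<in> wspace W"
  proof (rule wspace_closed)
    fix \<epsilon> :: real assume "0 < \<epsilon>"
    then obtain M where "wnorm W (\<lambda>i. d M i - e i) \<le> ennreal \<epsilon>" using tail by blast
    then have "wnorm W (\<lambda>i. e i - d M i) \<le> ennreal \<epsilon>"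
      using wnorm_uminus[of "\<lambda>i. d M i - e i"] by simp
    with d show "\<exists>f\<in>wspace W. wnorm W (\<lambda>i. e i - f i) \<le> ennreal \<epsilon>" by blast
  qed
  moreover have "(\<lambda>k. wnorm_real W (\<lambda>i. d k i - e i)) \<longlonglongrightarrow> 0"
  proof (rule LIMSEQ_I)
    fix r :: real assume "0 < r"
    then obtain M where M: "\<And>m. m \<ge> M \<Longrightarrow> wnorm W (\<lambda>i. d m i - e i) \<le> ennreal (r/2)"
      using tail[of "r/2"] by auto
    have "norm (wnorm_real W (\<lambda>i. d m i - e i) - 0) < r" if "m \<ge> M" for m
      using wnorm_real_le[OF M[OF that]] \<open>0 < r\<close> wnorm_real_nonneg[of "\<lambda>i. d m i - e i"] by simp
    then show "\<exists>no. \<forall>n\<ge>no. norm (wnorm_real W (\<lambda>i. d n i - e i) - 0) < r" by blast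
  qed
  ultimately show ?thesis by blast
qed

end

section \<open>Banach lattices of weighted functions\<close>

lemma null_sequence_squeeze:
  fixes f g :: "nat \<Rightarrow> real"
  assumes "g \<longlonglongrightarrow> 0" "\<And>k. 0 \<le> f k" "\<And>k. f k \<le> g k"
  shows "f \<longlonglongrightarrow> 0"
  by (rule tendsto_sandwich[OF _ _ tendsto_const assms(1)]) (simp_all add: assms)

context weight_family
begin

text \<open>A linear isometry from \<^term>\<open>wspace W\<close> onto a carrier transports the coordinatewise order, and
  with it the structure of a Banach lattice.\<close>
lemma banach_lattice_transport:
  fixes V :: "('v, 'z) normed_module_scheme" and \<psi> :: "('i \<Rightarrow> real) \<Rightarrow> 'v"
  assumes bij: "bij_betw \<psi> (wspace W) (carrier V)"
    and zero: "\<psi> (\<lambda>i. 0) = \<zero>\<^bsub>V\<^esub>"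
    and add: "\<And>d e. d \<in> wspace W \<Longrightarrow> e \<in> wspace W \<Longrightarrow> \<psi> d \<oplus>\<^bsub>V\<^esub> \<psi> e = \<psi> (\<lambda>i. d i + e i)"
    and smult: "\<And>c d. d \<in> wspace W \<Longrightarrow> c \<odot>\<^bsub>V\<^esub> \<psi> d = \<psi> (\<lambda>i. c * d i)"
    and norm: "\<And>d. d \<in> wspace W \<Longrightarrow> vnorm V (\<psi> d) = wnorm_real W d"
  shows "\<exists>leq. banach_lattice V leq"
proof -
  define \<phi> where "\<phi> = inv_into (wspace W) \<psi>"
  define leq where "leq u v \<longleftrightarrow> (\<forall>i. \<phi> u i \<le> \<phi> v i)" for u v
  define L where "L = order_on_carrier V leq"
  note mem = wspace_zero wspace_add wspace_diff wspace_max wspace_min wspace_scale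
  have \<phi> [simp]: "\<phi> (\<psi> d) = d" if "d \<in> wspace W" for d
    unfolding \<phi>_def using bij that by (simp add: bij_betw_def)
  have car: "\<psi> d \<in> carrier V" if "d \<in> wspace W" for d
    using bij that by (auto simp: bij_betw_def)
  have inj: "\<psi> d = \<psi> e \<longleftrightarrow> d = e" if "d \<in> wspace W" "e \<in> wspace W" for d e
    by (metis \<phi>[OF that(1)] \<phi>[OF that(2)])
  have ex: "\<exists>d\<in>wspace W. u = \<psi> d" if "u \<in> carrier V" for u
    using bij that by (auto simp: bij_betw_def)
  have neg: "(\<lambda>i. - d i) \<in> wspace W" if "d \<in> wspace W" for d
    using mem(6)[OF that, of "-1"] by simp
  have leq: "leq (\<psi> d) (\<psi> e) \<longleftrightarrow> (\<forall>i. d i \<le> e i)" if "d \<in> wspace W" "e \<in> wspace W" for d e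
    using that by (simp add: leq_def)

  have group: "abelian_group V"
  proof (rule abelian_groupI)
    show "\<exists>v\<in>carrier V. v \<oplus>\<^bsub>V\<^esub> u = \<zero>\<^bsub>V\<^esub>" if "u \<in> carrier V" for u
    proof -
      obtain d where d: "d \<in> wspace W" "u = \<psi> d" using ex[OF \<open>u \<in> carrier V\<close>] by blast
      then show ?thesis using neg[OF d(1)] car
        by (intro bexI[of _ "\<psi> (\<lambda>i. - d i)"]) (auto simp: add zero[symmetric])
    qed
  qed (auto dest!: ex simp: zero[symmetric] add mem car algebra_simps)
  interpret V: abelian_group V by (rule group)
  have "cring real_ring"
  proof (rule cringI)
    show "abelian_group real_ring"
    proof (rule abelian_groupI)
      show "\<exists>s\<in>carrier real_ring. s \<oplus>\<^bsub>real_ring\<^esub> r = \<zero>\<^bsub>real_ring\<^esub>" for r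
        by (rule bexI[of _ "- r"]) (simp_all add: real_ring_def)
    qed (simp_all add: real_ring_def)
    show "comm_monoid real_ring"
      by (rule comm_monoidI) (simp_all add: real_ring_def)
  qed (simp add: real_ring_def algebra_simps)
  then have module: "module real_ring V"
    by (rule moduleI[OF _ group])
      (auto dest!: ex simp: real_ring_def smult add mem car algebra_simps)
  have uminus: "\<ominus>\<^bsub>V\<^esub> \<psi> d = \<psi> (\<lambda>i. - d i)" if "d \<in> wspace W" for d
    by (rule V.minus_equality) (use that neg[OF that] car in \<open>auto simp: add zero[symmetric]\<close>)
  have minus: "\<psi> d \<ominus>\<^bsub>V\<^esub> \<psi> e = \<psi> (\<lambda>i. d i - e i)" if "d \<in> wspace W" "e \<in> wspace W" for d e
    using that neg by (simp add: a_minus_def uminus add)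

  have L [simp]: "carrier L = carrier V" "le L = leq" "eq L = (=)"
    by (simp_all add: L_def order_on_carrier_def)
  interpret L: partial_order L
  proof
    fix x y assume xy: "x \<sqsubseteq>\<^bsub>L\<^esub> y" "y \<sqsubseteq>\<^bsub>L\<^esub> x" "x \<in> carrier L" "y \<in> carrier L"
    show "x .=\<^bsub>L\<^esub> y"
    proof -
      obtain d e where de: "d \<in> wspace W" "x = \<psi> d" "e \<in> wspace W" "y = \<psi> e"
        using ex xy(3,4) by (metis L(1))
      then have "\<forall>i. d i \<le> e i" "\<forall>i. e i \<le> d i" using xy(1,2) by (simp_all add: leq)
      then have "d = e" by (simp add: fun_eq_iff order_antisym)
      with de show ?thesis by simp
    qed
  next
    fix x y z assume "x \<sqsubseteq>\<^bsub>L\<^esub> y" "y \<sqsubseteq>\<^bsub>L\<^esub> z"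
    then have xyz: "leq x y" "leq y z" by simp_all
    have "leq x z" unfolding leq_def
    proof
      fix i
      have "\<phi> x i \<le> \<phi> y i" "\<phi> y i \<le> \<phi> z i" using xyz by (simp_all add: leq_def)
      then show "\<phi> x i \<le> \<phi> z i" by (rule order_trans)
    qed
    then show "x \<sqsubseteq>\<^bsub>L\<^esub> z" by simp
  qed (auto simp: leq_def)
  have sup: "least L (\<psi> (\<lambda>i. max (d i) (e i))) (Upper L {\<psi> d, \<psi> e})"
    if "d \<in> wspace W" "e \<in> wspace W" for d e
  proof (rule least_UpperI)
    fix u assume u: "u \<in> Upper L {\<psi> d, \<psi> e}"
    then obtain f where "f \<in> wspace W" "u = \<psi> f"
      using ex by (auto simp: Upper_def)
    then show "\<psi> (\<lambda>i. max (d i) (e i)) \<sqsubseteq>\<^bsub>L\<^esub> u"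
      using u that by (auto simp: Upper_def leq mem car)
  qed (use that in \<open>auto simp: leq mem car\<close>)
  have inf: "greatest L (\<psi> (\<lambda>i. min (d i) (e i))) (Lower L {\<psi> d, \<psi> e})"
    if "d \<in> wspace W" "e \<in> wspace W" for d e
  proof (rule greatest_LowerI)
    fix u assume u: "u \<in> Lower L {\<psi> d, \<psi> e}"
    then obtain f where "f \<in> wspace W" "u = \<psi> f"
      using ex by (auto simp: Lower_def)
    then show "u \<sqsubseteq>\<^bsub>L\<^esub> \<psi> (\<lambda>i. min (d i) (e i))"
      using u that by (auto simp: Lower_def leq mem car)
  qed (use that in \<open>auto simp: leq mem car\<close>)
  interpret L: lattice L
  proof
    show "\<exists>s. least L s (Upper L {u, v})" if "u \<in> carrier L" "v \<in> carrier L" for u v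
      using ex sup that by (metis L(1))
    show "\<exists>s. greatest L s (Lower L {u, v})" if "u \<in> carrier L" "v \<in> carrier L" for u v
      using ex inf that by (metis L(1))
  qed
  have labs: "labs V leq (\<psi> d) = \<psi> (\<lambda>i. \<bar>d i\<bar>)" if d: "d \<in> wspace W" for d
  proof -
    have "\<psi> d \<squnion>\<^bsub>L\<^esub> \<psi> (\<lambda>i. - d i) = \<psi> (\<lambda>i. max (d i) (- d i))"
    proof (rule L.joinI)
      fix l assume "least L l (Upper L {\<psi> d, \<psi> (\<lambda>i. - d i)})"
      then show "l = \<psi> (\<lambda>i. max (d i) (- d i))"
        using sup[OF d neg[OF d]] by (rule L.least_unique)
    qed (simp_all add: car d neg)
    moreover have "(\<lambda>i. max (d i) (- d i)) = (\<lambda>i. \<bar>d i\<bar>)" by (auto simp: fun_eq_iff max_def)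
    ultimately show ?thesis
      unfolding labs_def L_def[symmetric] uminus[OF d] by simp
  qed
  have abs_mem: "(\<lambda>i. \<bar>d i\<bar>) \<in> wspace W" if "d \<in> wspace W" for d
    using that by (rule wspace_solid_add[OF _ wspace_zero]) simp

  have "banach_lattice V leq"
  proof (intro banach_lattice.intro banach_lattice_axioms.intro real_banach_space.intro
      real_banach_space_axioms.intro real_normed_space.intro)
    show "module real_ring V" by (rule module)
    fix u v and c :: real
    assume u: "u \<in> carrier V"
    then obtain d where d: "d \<in> wspace W" "u = \<psi> d" using ex by blast
    show "0 \<le> vnorm V u" "vnorm V u = 0 \<longleftrightarrow> u = \<zero>\<^bsub>V\<^esub>" "vnorm V (c \<odot>\<^bsub>V\<^esub> u) = \<bar>c\<bar> * vnorm V u"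
      using d by (simp_all add: norm smult mem wnorm_real_nonneg wnorm_real_eq_0_iff wnorm_real_scale
          inj[OF _ wspace_zero] zero[symmetric])
    assume v: "v \<in> carrier V"
    then obtain e where e: "e \<in> wspace W" "v = \<psi> e" using ex by blast
    show "vnorm V (u \<oplus>\<^bsub>V\<^esub> v) \<le> vnorm V u + vnorm V v"
      using d e by (simp add: add norm mem wnorm_real_add)
  next
    fix s :: "nat \<Rightarrow> 'v"
    assume s: "\<And>n. s n \<in> carrier V"
      and Cauchy: "\<And>\<epsilon>. 0 < \<epsilon> \<Longrightarrow> \<exists>M. \<forall>m\<ge>M. \<forall>n\<ge>M. vnorm V (s m \<ominus>\<^bsub>V\<^esub> s n) < \<epsilon>"
    define d where "d n = \<phi> (s n)" for n
    have d: "d n \<in> wspace W" "s n = \<psi> (d n)" for n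
      using ex[OF s[of n]] by (auto simp: d_def)
    obtain e where "e \<in> wspace W" "(\<lambda>k. wnorm_real W (\<lambda>i. d k i - e i)) \<longlonglongrightarrow> 0"
      using wspace_complete[of d] Cauchy by (auto simp: d minus norm mem)
    then show "\<exists>l\<in>carrier V. (\<lambda>n. vnorm V (s n \<ominus>\<^bsub>V\<^esub> l)) \<longlonglongrightarrow> 0"
      by (intro bexI[of _ "\<psi> e"]) (auto simp: d minus norm mem car)
  next
    show "lattice (order_on_carrier V leq)"
      using L.lattice_axioms by (simp add: L_def)
  next
    fix u v w
    assume *: "u \<in> carrier V" "v \<in> carrier V" "w \<in> carrier V" "leq u v"
    then obtain d e f where "d \<in> wspace W" "u = \<psi> d" "e \<in> wspace W" "v = \<psi> e" "f \<in> wspace W" "w = \<psi> f"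
      using ex by metis
    with * show "leq (u \<oplus>\<^bsub>V\<^esub> w) (v \<oplus>\<^bsub>V\<^esub> w)" by (simp add: add mem leq)
  next
    fix u v and c :: real
    assume *: "u \<in> carrier V" "v \<in> carrier V" "0 \<le> c" "leq u v"
    then obtain d e where "d \<in> wspace W" "u = \<psi> d" "e \<in> wspace W" "v = \<psi> e"
      using ex by metis
    with * show "leq (c \<odot>\<^bsub>V\<^esub> u) (c \<odot>\<^bsub>V\<^esub> v)" by (simp add: smult mem leq mult_left_mono)
  next
    fix u v
    assume *: "u \<in> carrier V" "v \<in> carrier V" "leq (labs V leq u) (labs V leq v)"
    then obtain d e where "d \<in> wspace W" "u = \<psi> d" "e \<in> wspace W" "v = \<psi> e"
      using ex by metis
    with * show "vnorm V u \<le> vnorm V v" by (simp add: norm labs leq abs_mem wnorm_real_mono)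
  qed
  then show ?thesis by blast
qed

text \<open>If a space maps linearly into \<^term>\<open>wspace W\<close>, with its seminorm pulled back from there and
  every finitely supported function in the image, then its completion is \<^term>\<open>wspace W\<close>: the
  element \<open>d\<close> corresponds to the class \<open>K d\<close> of all sequences whose images converge to \<open>d\<close>. The
  seminorm need not be known to be definite beforehand.\<close>
lemma banach_lattice_norm_completion:
  fixes N :: "'v::real_vector \<Rightarrow> real" and \<phi> :: "'v \<Rightarrow> 'i \<Rightarrow> real"
  assumes add: "\<And>u v i. \<phi> (u + v) i = \<phi> u i + \<phi> v i"
    and scale: "\<And>c u i. \<phi> (c *\<^sub>R u) i = c * \<phi> u i"
    and mem: "\<And>u. \<phi> u \<in> wspace W"
    and N: "\<And>u. N u = wnorm_real W (\<phi> u)"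
    and finite_support: "\<And>F d. finite F \<Longrightarrow> (\<And>i. i \<notin> F \<Longrightarrow> d i = 0) \<Longrightarrow> \<exists>u. \<phi> u = d"
  shows "\<exists>leq. banach_lattice (norm_completion N) leq"
proof -
  define conv where "conv s d \<longleftrightarrow> (\<lambda>k. wnorm_real W (\<lambda>i. \<phi> (s k) i - d i)) \<longlonglongrightarrow> 0" for s d
  define K where "K d = {s. conv s d}" for d
  have diff: "\<phi> (u - v) i = \<phi> u i - \<phi> v i" for u v i
    using add[of "u - v" v i] by simp
  have \<phi>_0: "\<phi> 0 i = 0" for i using scale[of 0 0 i] by simp
  have triangle: "wnorm_real W (\<lambda>i. d i - f i)
      \<le> wnorm_real W (\<lambda>i. d i - e i) + wnorm_real W (\<lambda>i. e i - f i)"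
    if "d \<in> wspace W" "e \<in> wspace W" "f \<in> wspace W" for d e f
    using wnorm_real_add[OF wspace_diff[OF that(1,2)] wspace_diff[OF that(2,3)]] by simp
  note comm = wnorm_real_minus_commute

  have conv_D: "\<exists>M. \<forall>k\<ge>M. wnorm_real W (\<lambda>i. \<phi> (s k) i - d i) < \<epsilon>" if "conv s d" "0 < \<epsilon>" for s d \<epsilon>
    using LIMSEQ_D[OF that(1)[unfolded conv_def] that(2)] by (auto simp: wnorm_real_nonneg)
  have conv_Cauchy: "cauchy_seq N s" if "conv s d" "d \<in> wspace W" for s d
    unfolding cauchy_seq_def
  proof (intro allI impI)
    fix \<epsilon> :: real assume "0 < \<epsilon>"
    then obtain M where M: "\<And>k. k \<ge> M \<Longrightarrow> wnorm_real W (\<lambda>i. \<phi> (s k) i - d i) < \<epsilon>/2"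
      using conv_D[OF \<open>conv s d\<close>, of "\<epsilon>/2"] by auto
    have "N (s m - s n) < \<epsilon>" if "m \<ge> M" "n \<ge> M" for m n
      using triangle[OF mem[of "s m"] \<open>d \<in> wspace W\<close> mem[of "s n"]] M[OF that(1)] M[OF that(2)]
        comm[of d "\<phi> (s n)"]
      by (simp add: N diff[abs_def])
    then show "\<exists>M. \<forall>m\<ge>M. \<forall>n\<ge>M. N (s m - s n) < \<epsilon>" by blast
  qed
  have Cauchy_conv: "\<exists>d\<in>wspace W. conv s d" if "cauchy_seq N s" for s
    using wspace_complete[of "\<lambda>k. \<phi> (s k)"] that mem
    by (simp add: cauchy_seq_def N diff[abs_def] conv_def)
  have conv_ex: "\<exists>s. conv s d" if "d \<in> wspace W" for d
  proof -
    have "\<exists>u. wnorm_real W (\<lambda>i. \<phi> u i - d i) \<le> 1 / Suc k" for k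
    proof -
      obtain F where F: "finite F" "wnorm W (\<lambda>i. if i \<in> F then 0 else d i) \<le> ennreal (1 / Suc k)"
        by (rule wspaceD[OF \<open>d \<in> wspace W\<close>, of "1 / Suc k"]) auto
      obtain u where "\<phi> u = (\<lambda>i. if i \<in> F then d i else 0)"
        using finite_support[OF F(1), of "\<lambda>i. if i \<in> F then d i else 0"] by auto
      then have "(\<lambda>i. \<phi> u i - d i) = (\<lambda>i. - (if i \<in> F then 0 else d i))" by auto
      then have "wnorm W (\<lambda>i. \<phi> u i - d i) \<le> ennreal (1 / Suc k)"
        using F(2) wnorm_uminus[of "\<lambda>i. if i \<in> F then 0 else d i"] by simp
      then show ?thesis using wnorm_real_le by (intro exI[of _ u]) simp
    qed
    then obtain s where "\<And>k. wnorm_real W (\<lambda>i. \<phi> (s k) i - d i) \<le> 1 / Suc k" by metis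
    then have "conv s d"
      unfolding conv_def
      by (intro null_sequence_squeeze[OF LIMSEQ_Suc[OF lim_1_over_n]]) (simp_all add: wnorm_real_nonneg)
    then show ?thesis by blast
  qed
  have conv_unique: "d = e" if "conv s d" "conv s e" "d \<in> wspace W" "e \<in> wspace W" for s d e
  proof -
    have "(\<lambda>k. wnorm_real W (\<lambda>i. \<phi> (s k) i - d i) + wnorm_real W (\<lambda>i. \<phi> (s k) i - e i)) \<longlonglongrightarrow> 0 + 0"
      using that(1,2) unfolding conv_def by (rule tendsto_add)
    moreover have "wnorm_real W (\<lambda>i. d i - e i)
        \<le> wnorm_real W (\<lambda>i. \<phi> (s k) i - d i) + wnorm_real W (\<lambda>i. \<phi> (s k) i - e i)" for k
      using triangle[OF that(3) mem[of "s k"] that(4)] comm[of d "\<phi> (s k)"] by simp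
    ultimately have "wnorm_real W (\<lambda>i. d i - e i) \<le> 0 + 0"
      by (intro LIMSEQ_le_const) auto
    then have "(\<lambda>i. d i - e i) = (\<lambda>i. 0)"
      using wnorm_real_eq_0_iff[OF wspace_diff[OF that(3,4)]]
        wnorm_real_nonneg[of "\<lambda>i. d i - e i"] by linarith
    then show ?thesis by (auto simp: fun_eq_iff)
  qed
  have conv_near: "conv t d \<longleftrightarrow> (\<lambda>k. N (t k - s k)) \<longlonglongrightarrow> 0" if "conv s d" "d \<in> wspace W" for s t d
  proof
    assume t: "conv t d"
    have lim: "(\<lambda>k. wnorm_real W (\<lambda>i. \<phi> (t k) i - d i) + wnorm_real W (\<lambda>i. \<phi> (s k) i - d i)) \<longlonglongrightarrow> 0"
      using that(1) t unfolding conv_def by (intro tendsto_add_zero)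
    have bound: "N (t k - s k)
        \<le> wnorm_real W (\<lambda>i. \<phi> (t k) i - d i) + wnorm_real W (\<lambda>i. \<phi> (s k) i - d i)" for k
      using triangle[OF mem[of "t k"] that(2) mem[of "s k"]] comm[of d "\<phi> (s k)"]
      by (simp add: N diff[abs_def])
    show "(\<lambda>k. N (t k - s k)) \<longlonglongrightarrow> 0"
      by (rule null_sequence_squeeze[OF lim _ bound]) (simp_all add: N wnorm_real_nonneg)
  next
    assume t: "(\<lambda>k. N (t k - s k)) \<longlonglongrightarrow> 0"
    have lim: "(\<lambda>k. N (t k - s k) + wnorm_real W (\<lambda>i. \<phi> (s k) i - d i)) \<longlonglongrightarrow> 0"
      using that(1) t unfolding conv_def by (intro tendsto_add_zero)
    have bound: "wnorm_real W (\<lambda>i. \<phi> (t k) i - d i)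
        \<le> N (t k - s k) + wnorm_real W (\<lambda>i. \<phi> (s k) i - d i)" for k
      using triangle[OF mem[of "t k"] mem[of "s k"] that(2)] by (simp add: N diff[abs_def])
    show "conv t d"
      unfolding conv_def
      by (rule null_sequence_squeeze[OF lim _ bound]) (simp_all add: wnorm_real_nonneg)
  qed
  have cls: "cauchy_class N s = K d" if "conv s d" "d \<in> wspace W" for s d
    unfolding cauchy_class_def K_def conv_near[OF that, symmetric]
    using conv_Cauchy that(2) by blast
  have rep: "conv (cauchy_rep (K d)) d" if "d \<in> wspace W" for d
    using someI_ex[of "\<lambda>s. s \<in> K d"] conv_ex[OF that]
    by (simp add: cauchy_rep_def K_def)

  show ?thesis
  proof (rule banach_lattice_transport[of K])
    show "bij_betw K (wspace W) (carrier (norm_completion N))"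
      unfolding bij_betw_def
    proof
      show "inj_on K (wspace W)"
      proof (rule inj_onI)
        fix d e assume *: "d \<in> wspace W" "e \<in> wspace W" "K d = K e"
        then have "conv (cauchy_rep (K d)) e" using rep[of e] by simp
        then show "d = e" using conv_unique rep[of d] * by blast
      qed
      show "K ` wspace W = carrier (norm_completion N)"
      proof (intro equalityI subsetI)
        fix P assume "P \<in> K ` wspace W"
        then obtain d where d: "d \<in> wspace W" "P = K d" by blast
        then obtain s where "conv s d" using conv_ex by blast
        with d have "cauchy_seq N s" "P = cauchy_class N s" by (simp_all add: cls conv_Cauchy[of s d])
        then show "P \<in> carrier (norm_completion N)" by (auto simp: norm_completion_def)
      next
        fix P assume "P \<in> carrier (norm_completion N)"
        then obtain s where "cauchy_seq N s" "P = cauchy_class N s"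
          by (auto simp: norm_completion_def)
        moreover from this obtain d where "d \<in> wspace W" "conv s d" using Cauchy_conv by blast
        ultimately show "P \<in> K ` wspace W" using cls by blast
      qed
    qed
    show "K (\<lambda>i. 0) = \<zero>\<^bsub>norm_completion N\<^esub>"
      using cls[of "\<lambda>k. 0" "\<lambda>i. 0"] wspace_zero
      by (simp add: norm_completion_def conv_def \<phi>_0 wnorm_real_def)
  next
    fix d e assume d: "d \<in> wspace W" and e: "e \<in> wspace W"
    let ?s = "cauchy_rep (K d)" and ?t = "cauchy_rep (K e)"
    have lim: "(\<lambda>k. wnorm_real W (\<lambda>i. \<phi> (?s k) i - d i) + wnorm_real W (\<lambda>i. \<phi> (?t k) i - e i)) \<longlonglongrightarrow> 0"
      using rep[OF d] rep[OF e] unfolding conv_def by (rule tendsto_add_zero)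
    have bound: "wnorm_real W (\<lambda>i. \<phi> (?s k + ?t k) i - (d i + e i))
        \<le> wnorm_real W (\<lambda>i. \<phi> (?s k) i - d i) + wnorm_real W (\<lambda>i. \<phi> (?t k) i - e i)" for k
      using wnorm_real_add[OF wspace_diff[OF mem[of "?s k"] d] wspace_diff[OF mem[of "?t k"] e]]
      by (simp add: add algebra_simps)
    have "conv (\<lambda>k. ?s k + ?t k) (\<lambda>i. d i + e i)"
      unfolding conv_def
      by (rule null_sequence_squeeze[OF lim _ bound]) (simp_all add: wnorm_real_nonneg)
    then show "K d \<oplus>\<^bsub>norm_completion N\<^esub> K e = K (\<lambda>i. d i + e i)"
      using cls[OF _ wspace_add[OF d e]] by (simp add: norm_completion_def)
  next
    fix c d assume d: "d \<in> wspace W"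
    let ?s = "cauchy_rep (K d)"
    have "(\<lambda>k. \<bar>c\<bar> * wnorm_real W (\<lambda>i. \<phi> (?s k) i - d i)) \<longlonglongrightarrow> \<bar>c\<bar> * 0"
      using rep[OF d] unfolding conv_def by (intro tendsto_mult tendsto_const)
    then have "conv (\<lambda>k. c *\<^sub>R ?s k) (\<lambda>i. c * d i)"
      by (simp add: conv_def scale right_diff_distrib[symmetric] wnorm_real_scale)
    then show "c \<odot>\<^bsub>norm_completion N\<^esub> K d = K (\<lambda>i. c * d i)"
      using cls[OF _ wspace_scale[OF d]] by (simp add: norm_completion_def)
  next
    fix d assume d: "d \<in> wspace W"
    let ?s = "cauchy_rep (K d)"
    have "\<bar>N (?s k) - wnorm_real W d\<bar> \<le> wnorm_real W (\<lambda>i. \<phi> (?s k) i - d i)" for k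
      using triangle[OF mem[of "?s k"] d wspace_zero] triangle[OF d mem[of "?s k"] wspace_zero]
        comm[of d "\<phi> (?s k)"]
      by (simp add: N)
    then have "(\<lambda>k. N (?s k) - wnorm_real W d) \<longlonglongrightarrow> 0"
      by (intro Lim_null_comparison[OF _ rep[OF d, unfolded conv_def]]) simp
    then have "(\<lambda>k. N (?s k)) \<longlonglongrightarrow> wnorm_real W d"
      by (rule LIM_zero_cancel)
    then show "vnorm (norm_completion N) (K d) = wnorm_real W d"
      by (simp add: norm_completion_def limI)
  qed
qed

end

section \<open>Norming functionals\<close>

text \<open>Only \<open>p (t *\<^sub>R u) \<le> t * p u\<close> is required for \<open>t \<ge> 0\<close>; equality follows by scaling back.\<close>
definition sublinear :: "('a::real_vector \<Rightarrow> real) \<Rightarrow> bool" where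
  "sublinear p \<longleftrightarrow> (\<forall>u v. p (u + v) \<le> p u + p v) \<and> (\<forall>t\<ge>0. \<forall>u. p (t *\<^sub>R u) \<le> t * p u)"

lemma sublinear_0:
  assumes "sublinear p"
  shows "p 0 = 0"
proof -
  have "p (0 + 0) \<le> p 0 + p 0" "p (0 *\<^sub>R 0) \<le> 0 * p 0"
    using assms unfolding sublinear_def by blast+
  then show ?thesis by simp
qed

lemma sublinear_scale:
  assumes "sublinear p" "0 \<le> t"
  shows "p (t *\<^sub>R u) = t * p u"
proof (cases "t = 0")
  case False
  then have "p (inverse t *\<^sub>R (t *\<^sub>R u)) \<le> inverse t * p (t *\<^sub>R u)"
    using assms unfolding sublinear_def by (metis inverse_nonnegative_iff_nonnegative)
  with False assms(2) have "t * p u \<le> p (t *\<^sub>R u)" by (simp add: field_simps)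
  with assms show ?thesis unfolding sublinear_def by (meson antisym)
qed (use sublinear_0[OF assms(1)] in simp)

lemma sublinear_lower:
  assumes "sublinear p"
  shows "- p (- u) \<le> p u"
proof -
  have "p (u + (- u)) \<le> p u + p (- u)" using assms unfolding sublinear_def by blast
  then show ?thesis using sublinear_0[OF assms] by simp
qed

text \<open>A sublinear functional \<open>q\<close> can be lowered in the direction \<open>v\<close> to
  \<open>r u = (INF t\<ge>0. q (u + t *\<^sub>R v) - t * q v)\<close>, which is still sublinear. If \<open>q\<close> is minimal, then
  \<open>r = q\<close>, and the last inequality makes \<open>q\<close> additive. This replaces the extension of a
  functional from subspaces in the proof of the Hahn--Banach theorem.\<close>
lemma sublinear_reduction:
  assumes q: "sublinear q"
  obtains r where "sublinear r" "\<And>u. r u \<le> q u" "\<And>u. r u \<le> q (u + v) - q v"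
proof
  \<comment> \<open>\<open>S u\<close> collects the competitors for the infimum that defines \<open>r u\<close>; its elements are at least \<open>- q (- u)\<close>.\<close>
  define S where "S u = (\<lambda>t. q (u + t *\<^sub>R v) - t * q v) ` {0..}" for u
  define r where "r u = Inf (S u)" for u
  have below: "- q (- u) \<le> s" if "s \<in> S u" for s u
  proof -
    obtain t where t: "t \<ge> 0" "s = q (u + t *\<^sub>R v) - t * q v" using \<open>s \<in> S u\<close> by (auto simp: S_def)
    have "q ((u + t *\<^sub>R v) + (- u)) \<le> q (u + t *\<^sub>R v) + q (- u)"
      using q unfolding sublinear_def by blast
    then show ?thesis using t sublinear_scale[OF q t(1), of v] by simp
  qed
  then have bdd: "bdd_below (S u)" for u by (rule bdd_belowI)
  have ne: "S u \<noteq> {}" for u by (auto simp: S_def)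
  have r_le: "r u \<le> q (u + t *\<^sub>R v) - t * q v" if "t \<ge> 0" for u t
    unfolding r_def by (rule cInf_lower[OF _ bdd]) (use that in \<open>auto simp: S_def\<close>)
  show "r u \<le> q u" for u using r_le[of 0 u] by simp
  show "r u \<le> q (u + v) - q v" for u using r_le[of 1 u] by simp
  have r_near: "\<exists>t\<ge>0. q (u + t *\<^sub>R v) - t * q v < r u + \<epsilon>" if "0 < \<epsilon>" for u \<epsilon>
    using cInf_lessD[OF ne, of u "r u + \<epsilon>"] that by (auto simp: r_def S_def)
  show "sublinear r"
    unfolding sublinear_def
  proof (intro conjI allI impI)
    fix u w
    show "r (u + w) \<le> r u + r w"
    proof (rule field_le_epsilon)
      fix \<epsilon> :: real assume "0 < \<epsilon>"
      then obtain s t where s: "s \<ge> 0" "q (u + s *\<^sub>R v) - s * q v < r u + \<epsilon>/2"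
        and t: "t \<ge> 0" "q (w + t *\<^sub>R v) - t * q v < r w + \<epsilon>/2"
        using r_near[of "\<epsilon>/2"] by (metis half_gt_zero)
      have "q (u + w + (s + t) *\<^sub>R v) = q ((u + s *\<^sub>R v) + (w + t *\<^sub>R v))"
        by (simp add: algebra_simps)
      also have "\<dots> \<le> q (u + s *\<^sub>R v) + q (w + t *\<^sub>R v)"
        using q unfolding sublinear_def by blast
      finally show "r (u + w) \<le> r u + r w + \<epsilon>"
        using r_le[of "s + t" "u + w"] s t by (simp add: algebra_simps)
    qed
  next
    fix t :: real and u assume "0 \<le> t"
    show "r (t *\<^sub>R u) \<le> t * r u"
    proof (cases "t = 0")
      case True
      then show ?thesis using r_le[of 0 0] sublinear_0[OF q] by simp
    next
      case False
      with \<open>0 \<le> t\<close> have "0 < t" by simp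
      have "r (t *\<^sub>R u) / t \<le> r u"
      proof (unfold r_def[of u], rule cInf_greatest[OF ne])
        fix s assume "s \<in> S u"
        then obtain \<tau> where \<tau>: "\<tau> \<ge> 0" "s = q (u + \<tau> *\<^sub>R v) - \<tau> * q v" by (auto simp: S_def)
        have "r (t *\<^sub>R u) \<le> q (t *\<^sub>R u + (t * \<tau>) *\<^sub>R v) - (t * \<tau>) * q v"
          using \<open>0 < t\<close> \<tau> by (intro r_le) simp
        also have "q (t *\<^sub>R u + (t * \<tau>) *\<^sub>R v) = t * q (u + \<tau> *\<^sub>R v)"
          using sublinear_scale[OF q \<open>0 \<le> t\<close>, of "u + \<tau> *\<^sub>R v"] by (simp add: algebra_simps)
        finally have "r (t *\<^sub>R u) \<le> s * t"
          by (simp add: \<tau>(2) algebra_simps)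
        then show "r (t *\<^sub>R u) / t \<le> s"
          using \<open>0 < t\<close> by (simp add: pos_divide_le_eq)
      qed
      then show ?thesis using \<open>0 < t\<close> by (simp add: field_simps)
    qed
  qed
qed

lemma minimal_sublinear_linear:
  assumes q: "sublinear q" and min: "\<And>r. sublinear r \<Longrightarrow> (\<And>u. r u \<le> q u) \<Longrightarrow> r = q"
  shows "linear q"
proof -
  have add: "q (u + v) = q u + q v" for u v
  proof -
    obtain r where r: "sublinear r" "\<And>u. r u \<le> q u" "\<And>u. r u \<le> q (u + v) - q v"
      by (rule sublinear_reduction[OF q, where v = v]) blast
    then have "r = q" by (intro min)
    then have "q u + q v \<le> q (u + v)" using r(3)[of u] by simp
    moreover have "q (u + v) \<le> q u + q v" using q unfolding sublinear_def by blast
    ultimately show ?thesis by simp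
  qed
  have neg: "q (- u) = - q u" for u
    using add[of u "- u"] sublinear_0[OF q] by simp
  have "q (c *\<^sub>R u) = c *\<^sub>R q u" for c u
  proof (cases "0 \<le> c")
    case False
    then show ?thesis using sublinear_scale[OF q, of "- c" u] neg[of "c *\<^sub>R u"] by simp
  qed (simp add: sublinear_scale[OF q])
  with add show ?thesis by (rule linearI)
qed

lemma hahn_banach_sublinear:
  assumes p: "sublinear p"
  obtains f where "linear f" "\<And>u. f u \<le> p u"
proof -
  define A where "A = {q. sublinear q \<and> (\<forall>u. q u \<le> p u)}"
  have "\<exists>m\<in>A. \<forall>q\<in>A. m \<ge> q \<longrightarrow> q = m"
  proof (rule predicate_Zorn)
    show "partial_order_on A (relation_of (\<ge>) A)"
      by (rule partial_order_on_relation_ofI) auto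
    fix C assume C: "C \<in> Chains (relation_of (\<ge>) A)"
    then have sub: "C \<subseteq> A" by (auto simp: Chains_def relation_of_def)
    have tot: "q \<le> r \<or> r \<le> q" if "q \<in> C" "r \<in> C" for q r
      using C that by (auto simp: Chains_def relation_of_def)
    show "\<exists>m\<in>A. \<forall>q\<in>C. q \<ge> m"
    proof (cases "C = {}")
      case True
      with p show ?thesis by (auto simp: A_def)
    next
      case False
      \<comment> \<open>The pointwise infimum of a chain is subadditive since two members of a chain have a common lower bound in it.\<close>
      define m where "m u = (INF q\<in>C. q u)" for u
      have bdd: "bdd_below ((\<lambda>q. q u) ` C)" for u
      proof (rule bdd_belowI2)
        fix q assume "q \<in> C"
        then have "sublinear q" "q (- u) \<le> p (- u)" using sub by (auto simp: A_def)
        then show "- p (- u) \<le> q u" using sublinear_lower[of q u] by simp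
      qed
      have m_le: "m u \<le> q u" if "q \<in> C" for q u
        unfolding m_def by (rule cINF_lower[OF bdd that])
      have "sublinear m"
        unfolding sublinear_def
      proof (intro conjI allI impI)
        fix u v
        have "m (u + v) - q u \<le> r v" if "q \<in> C" "r \<in> C" for q r
        proof -
          obtain s where s: "s \<in> C" "s \<le> q" "s \<le> r" using tot \<open>q \<in> C\<close> \<open>r \<in> C\<close> by blast
          have "m (u + v) \<le> s (u + v)" by (rule m_le[OF s(1)])
          also have "\<dots> \<le> s u + s v" using s(1) sub by (auto simp: A_def sublinear_def)
          also have "\<dots> \<le> q u + r v" using s by (intro add_mono) (auto simp: le_fun_def)
          finally show ?thesis by simp
        qed
        then have "m (u + v) - q u \<le> m v" if "q \<in> C" for q
          unfolding m_def[of v] using that False by (intro cINF_greatest) auto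
        then have "m (u + v) - m v \<le> q u" if "q \<in> C" for q
          using that[THEN \<open>\<And>q. q \<in> C \<Longrightarrow> m (u + v) - q u \<le> m v\<close>] by simp
        then have "m (u + v) - m v \<le> m u"
          unfolding m_def[of u] using False by (intro cINF_greatest) auto
        then show "m (u + v) \<le> m u + m v" by simp
      next
        fix t :: real and u assume t: "0 \<le> t"
        show "m (t *\<^sub>R u) \<le> t * m u"
        proof (cases "t = 0")
          case True
          obtain q where "q \<in> C" using False by blast
          then have "m 0 \<le> 0" using m_le[of q 0] sub sublinear_0[of q] by (auto simp: A_def)
          with True show ?thesis by simp
        next
          case t0: False
          with t have "0 < t" by simp
          have "m (t *\<^sub>R u) / t \<le> m u"
          proof (unfold m_def[of u], rule cINF_greatest[OF False])
            fix q assume "q \<in> C"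
            then have "m (t *\<^sub>R u) \<le> t * q u"
              using m_le[of q "t *\<^sub>R u"] sub sublinear_scale[of q t u] t by (auto simp: A_def)
            then show "m (t *\<^sub>R u) / t \<le> q u" using \<open>0 < t\<close> by (simp add: field_simps)
          qed
          then show ?thesis using \<open>0 < t\<close> by (simp add: field_simps)
        qed
      qed
      moreover have "m u \<le> p u" for u
      proof -
        obtain q where "q \<in> C" using False by blast
        then have "m u \<le> q u" "q u \<le> p u" using m_le sub by (auto simp: A_def)
        then show ?thesis by simp
      qed
      ultimately show ?thesis using m_le by (auto simp: A_def le_fun_def)
    qed
  qed
  then obtain m where m: "sublinear m" "\<And>u. m u \<le> p u" and min: "\<And>q. q \<in> A \<Longrightarrow> q \<le> m \<Longrightarrow> q = m"
    by (auto simp: A_def)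
  have "linear m"
  proof (rule minimal_sublinear_linear[OF m(1)])
    fix r assume r: "sublinear r" "\<And>u. r u \<le> m u"
    then have "r \<in> A" using m(2) by (auto simp: A_def intro: order_trans)
    then show "r = m" using r(2) by (intro min) (auto simp: le_fun_def)
  qed
  with m(2) show ?thesis by (rule that[rotated])
qed

text \<open>A linear functional below the reduction of the norm in the direction \<open>u\<close> attains the norm
  at \<open>u\<close>, because that reduction is at most \<open>- norm u\<close> at \<open>- u\<close>.\<close>
lemma norming_functional:
  fixes u :: "'a::real_normed_vector"
  obtains f :: "'a \<Rightarrow>\<^sub>L real" where "norm f \<le> 1" "blinfun_apply f u = norm u"
proof -
  have "sublinear (norm :: 'a \<Rightarrow> real)"
    by (auto simp: sublinear_def norm_triangle_ineq)
  then obtain r where r: "sublinear r" "\<And>v. r v \<le> norm v" "\<And>v. r v \<le> norm (v + u) - norm u"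
    by (rule sublinear_reduction[where v = u]) blast
  obtain f where f: "linear f" "\<And>v. f v \<le> r v"
    by (rule hahn_banach_sublinear[OF r(1)]) blast
  have le: "\<bar>f v\<bar> \<le> norm v" for v
    using f(2)[of v] r(2)[of v] f(2)[of "- v"] r(2)[of "- v"] linear_neg[OF f(1), of v] by simp
  have "f (- u) \<le> - norm u" using f(2)[of "- u"] r(3)[of "- u"] by simp
  then have "f u = norm u" using linear_neg[OF f(1), of u] le[of u] by simp
  moreover have "bounded_linear f"
    using f(1) le by (auto simp: bounded_linear_def bounded_linear_axioms_def intro!: exI[of _ 1])
  moreover have "norm (Blinfun f) \<le> 1"
    by (rule norm_blinfun_bound) (use le in \<open>auto simp: bounded_linear_Blinfun_apply[OF \<open>bounded_linear f\<close>]\<close>)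
  ultimately show ?thesis by (intro that[of "Blinfun f"]) (auto simp: bounded_linear_Blinfun_apply)
qed

section \<open>Tails of unconditionally convergent series\<close>

text \<open>An injective ranking of the indices yields a rearrangement, by listing them in increasing
  rank. Convergence of the rearranged series is then a Cauchy condition on the sums over all
  indices of rank below a threshold.\<close>
lemma unconditional_Cauchy_by_rank:
  fixes v :: "nat \<Rightarrow> 'a::banach" and rank :: "nat \<Rightarrow> nat"
  assumes perm: "\<And>\<pi>. bij \<pi> \<Longrightarrow> summable (\<lambda>m. v (\<pi> m))" and inj: "inj rank" and "0 < \<epsilon>"
  obtains M where "\<And>s t. M \<le> s \<Longrightarrow> M \<le> t \<Longrightarrow>
    norm ((\<Sum>m | rank m < s. v m) - (\<Sum>m | rank m < t. v m)) < \<epsilon>"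
proof -
  define R where "R = range rank"
  have "infinite R" unfolding R_def using inj by (simp add: range_inj_infinite)
  define \<pi> where "\<pi> k = inv_into UNIV rank (enumerate R k)" for k
  have rank_\<pi>: "rank (\<pi> k) = enumerate R k" for k
    unfolding \<pi>_def using enumerate_in_set[OF \<open>infinite R\<close>, of k] by (simp add: R_def f_inv_into_f)
  have "bij \<pi>"
  proof (rule bijI)
    show "inj \<pi>"
    proof (rule injI)
      fix j k assume "\<pi> j = \<pi> k"
      then have "enumerate R j = enumerate R k" by (metis rank_\<pi>)
      then show "j = k" by (rule injD[OF inj_enumerate[OF \<open>infinite R\<close>]])
    qed
    show "surj \<pi>"
    proof (rule surjI)
      fix m
      have "rank m \<in> enumerate R ` UNIV"
        unfolding range_enumerate[OF \<open>infinite R\<close>] by (simp add: R_def)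
      then have "enumerate R (inv_into UNIV (enumerate R) (rank m)) = rank m"
        by (rule f_inv_into_f)
      then show "\<pi> (inv_into UNIV (enumerate R) (rank m)) = m"
        by (simp add: \<pi>_def inj)
    qed
  qed
  have initial: "(\<Sum>m | rank m < t. v m) = (\<Sum>k<card {m. rank m < t}. v (\<pi> k))" for t
  proof -
    \<comment> \<open>\<open>K\<close> is an initial segment of the naturals, because \<^const>\<open>enumerate\<close> is increasing.\<close>
    define K where "K = {k. enumerate R k < t}"
    have "k < t" if "k \<in> K" for k
      using that le_enumerate[OF \<open>infinite R\<close>, of k] by (simp add: K_def)
    then have "finite K" by (intro finite_subset[of K "{..<t}"]) auto
    then obtain k0 where "k0 \<notin> K"
      using ex_new_if_finite[OF infinite_UNIV_nat] by blast
    then have least: "(LEAST k. k \<notin> K) \<notin> K" by (rule LeastI[of "\<lambda>k. k \<notin> K"])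
    have "k < (LEAST k. k \<notin> K)" if "k \<in> K" for k
    proof (rule ccontr)
      assume "\<not> ?thesis"
      then have "(LEAST k. k \<notin> K) \<in> K"
        using that enumerate_mono_le_iff[OF \<open>infinite R\<close>, of "LEAST k. k \<notin> K" k]
        by (simp add: K_def)
      with least show False by simp
    qed
    moreover have "k \<in> K" if "k < (LEAST k. k \<notin> K)" for k
      using not_less_Least[OF that] by simp
    ultimately obtain n where n: "K = {..<n}" by blast
    have "bij_betw \<pi> K {m. rank m < t}"
      unfolding bij_betw_def
    proof
      show "inj_on \<pi> K" by (rule inj_on_subset[OF bij_is_inj[OF \<open>bij \<pi>\<close>]]) simp
      show "\<pi> ` K = {m. rank m < t}"
      proof (intro equalityI subsetI)
        fix m assume "m \<in> {m. rank m < t}"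
        moreover obtain k where "m = \<pi> k" using bij_is_surj[OF \<open>bij \<pi>\<close>] by blast
        ultimately show "m \<in> \<pi> ` K" by (auto simp: K_def rank_\<pi>)
      qed (auto simp: K_def rank_\<pi>)
    qed
    from sum.reindex_bij_betw[OF this, of v] bij_betw_same_card[OF this] show ?thesis by (simp add: n)
  qed
  have "Cauchy (\<lambda>n. \<Sum>k<n. v (\<pi> k))"
    using perm[OF \<open>bij \<pi>\<close>] by (simp add: summable_iff_convergent convergent_Cauchy)
  from CauchyD[OF this \<open>0 < \<epsilon>\<close>]
  obtain M where M: "\<And>m n. M \<le> m \<Longrightarrow> M \<le> n \<Longrightarrow> norm ((\<Sum>k<m. v (\<pi> k)) - (\<Sum>k<n. v (\<pi> k))) < \<epsilon>"
    by auto
  show ?thesis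
  proof (rule that)
    fix s t
    have fin: "finite {m. rank m < t}" for t
      using finite_vimageI[OF _ inj, of "{..<t}"] by (simp add: vimage_def)
    let ?T = "Suc (Max (rank ` {..<M}))"
    have big: "M \<le> card {m. rank m < t}" if "?T \<le> t" for t
    proof -
      have "{..<M} \<subseteq> {m. rank m < t}"
      proof
        fix m assume "m \<in> {..<M}"
        then have "rank m \<le> Max (rank ` {..<M})" by (intro Max_ge) auto
        then show "m \<in> {m. rank m < t}" using that by simp
      qed
      from card_mono[OF fin this] show ?thesis by simp
    qed
    assume "?T \<le> s" "?T \<le> t"
    then show "norm ((\<Sum>m | rank m < s. v m) - (\<Sum>m | rank m < t. v m)) < \<epsilon>"
      unfolding initial by (intro M big)
  qed
qed

text \<open>If finite sums arbitrarily far out stay large, choose consecutive blocks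
  \<open>{N j ..< N (Suc j)}\<close>, each containing a finite set \<open>G (N j)\<close> with a large sum. The rearrangement
  that lists \<open>G (N j)\<close> first inside its block has partial sums that differ by that large sum.\<close>
lemma unconditional_tail:
  fixes v :: "nat \<Rightarrow> 'a::banach"
  assumes perm: "\<And>\<pi>. bij \<pi> \<Longrightarrow> summable (\<lambda>m. v (\<pi> m))" and "0 < \<epsilon>"
  shows "\<exists>M. \<forall>F. finite F \<longrightarrow> F \<subseteq> {M..} \<longrightarrow> norm (\<Sum>m\<in>F. v m) < \<epsilon>"
proof (rule ccontr)
  assume "\<not> ?thesis"
  then have "\<forall>M. \<exists>F. finite F \<and> F \<subseteq> {M..} \<and> \<epsilon> \<le> norm (\<Sum>m\<in>F. v m)"
    by (auto simp: not_less)
  then obtain G where G: "\<And>M. finite (G M)" "\<And>M. G M \<subseteq> {M..}" "\<And>M. \<epsilon> \<le> norm (\<Sum>m\<in>G M. v m)"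
    by metis
  define nxt where "nxt M = Suc (Max (insert M (G M)))" for M
  define N where "N j = (nxt ^^ j) 0" for j
  have N_0: "N 0 = 0" and N_Suc: "N (Suc j) = nxt (N j)" for j by (simp_all add: N_def)
  have nxt_gt: "M < nxt M" for M
    using G(1) by (simp add: nxt_def less_Suc_eq_le)
  have G_lt: "m < nxt M" if "m \<in> G M" for m M
    using G(1) that by (simp add: nxt_def less_Suc_eq_le)
  have "strict_mono N" by (rule strict_mono_Suc_iff[THEN iffD2]) (simp add: N_Suc nxt_gt)
  have "\<exists>j. N j \<le> m \<and> m < N (Suc j)" for m
  proof -
    have "m < N (Suc m)" using strict_mono_imp_increasing[OF \<open>strict_mono N\<close>, of "Suc m"] by simp
    then have *: "m < N (Suc (LEAST j. m < N (Suc j)))" by (rule LeastI[of "\<lambda>j. m < N (Suc j)"])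
    moreover have "N (LEAST j. m < N (Suc j)) \<le> m"
    proof (cases "LEAST j. m < N (Suc j)")
      case (Suc i)
      then have "\<not> m < N (Suc i)" by (metis lessI not_less_Least)
      with Suc show ?thesis by simp
    qed (simp add: N_0)
    ultimately show ?thesis by blast
  qed
  then obtain blk where blk: "\<And>m. N (blk m) \<le> m" "\<And>m. m < N (Suc (blk m))" by metis
  \<comment> \<open>The ranks of the block from \<open>N j\<close> to \<open>N (Suc j)\<close> fill part of the interval from \<open>2 * N j\<close> to \<open>2 * N (Suc j)\<close>,\<close>
  \<comment> \<open>and the threshold \<open>N j + N (Suc j)\<close> separates \<open>G (N j)\<close> from the rest of the block.\<close>
  define rank where "rank m = (if m \<in> G (N (blk m)) then N (blk m) + m else N (Suc (blk m)) + m)" for m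
  have mono: "N i \<le> N j \<longleftrightarrow> i \<le> j" "N i < N j \<longleftrightarrow> i < j" for i j
    using \<open>strict_mono N\<close> by (auto simp: strict_mono_less_eq strict_mono_less)
  have blk_eq: "blk m = j" if "N j \<le> m" "m < N (Suc j)" for m j
  proof -
    have "N j < N (Suc (blk m))" "N (blk m) < N (Suc j)" using that blk[of m] by linarith+
    then show ?thesis by (simp add: mono)
  qed
  have rank_ge: "N (blk m) + m \<le> rank m" "rank m < N (Suc (blk m)) + N (Suc (blk m))" for m
    using blk[of m] by (auto simp: rank_def)
  have lo: "rank m < N j + N j \<longleftrightarrow> m < N j" for m j
  proof
    assume "rank m < N j + N j"
    then have "N (blk m) < N j" using rank_ge(1)[of m] blk(1)[of m] by linarith
    then have "N (Suc (blk m)) \<le> N j" by (simp add: mono)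
    then show "m < N j" using blk(2)[of m] by simp
  next
    assume "m < N j"
    then have "N (blk m) < N j" using blk(1)[of m] by simp
    then have "N (Suc (blk m)) \<le> N j" by (simp add: mono)
    then show "rank m < N j + N j" using rank_ge(2)[of m] by simp
  qed
  have hi: "rank m < N j + N (Suc j) \<longleftrightarrow> m < N j \<or> m \<in> G (N j)" for m j
  proof (cases "N j \<le> m \<and> m < N (Suc j)")
    case True
    then have "blk m = j" using blk_eq by blast
    with True show ?thesis by (auto simp: rank_def)
  next
    case False
    then consider "m < N j" | "N (Suc j) \<le> m" by linarith
    then show ?thesis
    proof cases
      case 1
      then have "rank m < N j + N j" by (simp add: lo)
      then show ?thesis using 1 mono(2)[of j "Suc j"] by simp
    next
      case 2
      then have "\<not> rank m < N (Suc j) + N (Suc j)" by (simp add: lo)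
      moreover have "m \<notin> G (N j)" using 2 G_lt[of m "N j"] by (auto simp: N_Suc)
      moreover have "N j < N (Suc j)" by (simp add: mono)
      ultimately show ?thesis using 2 by simp
    qed
  qed
  have "inj rank"
  proof (rule injI)
    fix m n assume eq: "rank m = rank n"
    have b: "blk m = blk n"
    proof (rule blk_eq[symmetric, THEN sym])
      show "N (blk n) \<le> m"
        using lo[of m "blk n"] lo[of n "blk n"] blk[of n] eq by simp
      show "m < N (Suc (blk n))"
        using lo[of m "Suc (blk n)"] lo[of n "Suc (blk n)"] blk[of n] eq by simp
    qed
    then have "m \<in> G (N (blk n)) \<longleftrightarrow> n \<in> G (N (blk n))"
      using hi[of m "blk n"] hi[of n "blk n"] eq blk(1)[of m] blk(1)[of n] by simp
    with b eq show "m = n" by (auto simp: rank_def split: if_splits)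
  qed
  obtain M where M: "\<And>s t. M \<le> s \<Longrightarrow> M \<le> t \<Longrightarrow>
      norm ((\<Sum>m | rank m < s. v m) - (\<Sum>m | rank m < t. v m)) < \<epsilon>"
    by (rule unconditional_Cauchy_by_rank[where v = v, OF perm \<open>inj rank\<close> \<open>0 < \<epsilon>\<close>]) blast+
  have "M \<le> N M" by (rule strict_mono_imp_increasing[OF \<open>strict_mono N\<close>])
  then have "norm ((\<Sum>m | rank m < N M + N (Suc M). v m) - (\<Sum>m | rank m < N M + N M. v m)) < \<epsilon>"
    by (intro M) auto
  moreover have "{m. rank m < N M + N (Suc M)} = {..<N M} \<union> G (N M)" "{m. rank m < N M + N M} = {..<N M}"
    by (auto simp: lo hi)
  moreover have "(\<Sum>m\<in>{..<N M} \<union> G (N M). v m) = (\<Sum>m<N M. v m) + (\<Sum>m\<in>G (N M). v m)"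
  proof (rule sum.union_disjoint)
    show "{..<N M} \<inter> G (N M) = {}" using G(2)[of "N M"] by auto
  qed (use G(1) in auto)
  ultimately show False using G(3)[of "N M"] by simp
qed

section \<open>Weighted norms as series\<close>

lemma ennreal_suminf_le_iff:
  fixes f :: "nat \<Rightarrow> ennreal"
  shows "suminf (\<lambda>n. f n) \<le> C \<longleftrightarrow> (\<forall>N. (\<Sum>n<N. f n) \<le> C)"
  using sum_le_suminf[OF summableI, of "{..<N}" f for N] suminf_le_const[OF summableI, of f C]
  by (auto intro: order_trans)

text \<open>For one weight, the supremum of finite sums is the usual series.\<close>
lemma wnorm_singleton_nat:
  fixes w :: "nat \<Rightarrow> real"
  assumes "\<And>m. 0 \<le> w m"
  shows "suminf (\<lambda>m. ennreal (w m * \<bar>d m\<bar>)) = wnorm {w} d"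
proof (rule antisym)
  show "suminf (\<lambda>m. ennreal (w m * \<bar>d m\<bar>)) \<le> wnorm {w} d"
    unfolding ennreal_suminf_le_iff
    using sum_le_wnorm[of w "{w}" "{..<N}" d for N] by (simp add: assms)
  show "wnorm {w} d \<le> suminf (\<lambda>m. ennreal (w m * \<bar>d m\<bar>))"
  proof (rule wnorm_leI)
    fix v and F :: "nat set" assume F: "v \<in> {w}" "finite F"
    have "ennreal (\<Sum>m\<in>F. w m * \<bar>d m\<bar>) = (\<Sum>m\<in>F. ennreal (w m * \<bar>d m\<bar>))"
      by (rule sum_ennreal[symmetric]) (simp add: assms)
    also have "\<dots> \<le> suminf (\<lambda>m. ennreal (w m * \<bar>d m\<bar>))"
      by (rule sum_le_suminf) (simp_all add: F)
    finally show "ennreal (\<Sum>m\<in>F. v m * \<bar>d m\<bar>) \<le> suminf (\<lambda>m. ennreal (w m * \<bar>d m\<bar>))"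
      using F(1) by simp
  qed
qed

lemma wnorm_singleton_nat_prod:
  fixes w :: "nat \<times> nat \<Rightarrow> real"
  assumes "\<And>p. 0 \<le> w p"
  shows "suminf (\<lambda>m. suminf (\<lambda>n. ennreal (w (m, n) * \<bar>d (m, n)\<bar>))) = wnorm {w} d"
proof (rule antisym)
  let ?t = "\<lambda>m n. ennreal (w (m, n) * \<bar>d (m, n)\<bar>)"
  have rectangle: "(\<Sum>m<M. \<Sum>n<N. ?t m n) = ennreal (\<Sum>p\<in>{..<M} \<times> {..<N}. w p * \<bar>d p\<bar>)" for M N
  proof -
    have "(\<Sum>m<M. \<Sum>n<N. ?t m n) = (\<Sum>p\<in>{..<M} \<times> {..<N}. ennreal (w p * \<bar>d p\<bar>))"
      by (simp add: sum.cartesian_product case_prod_unfold del: sum_ennreal)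
    also have "\<dots> = ennreal (\<Sum>p\<in>{..<M} \<times> {..<N}. w p * \<bar>d p\<bar>)"
      by (rule sum_ennreal) (simp add: assms)
    finally show ?thesis .
  qed
  show "suminf (\<lambda>m. suminf (\<lambda>n. ?t m n)) \<le> wnorm {w} d"
    unfolding ennreal_suminf_le_iff
  proof
    fix M
    have "(\<Sum>m<M. suminf (\<lambda>n. ?t m n)) = suminf (\<lambda>n. \<Sum>m<M. ?t m n)"
      by (rule suminf_sum[symmetric]) simp
    also have "\<dots> \<le> wnorm {w} d"
      unfolding ennreal_suminf_le_iff
    proof
      fix N
      have "(\<Sum>n<N. \<Sum>m<M. ?t m n) = (\<Sum>m<M. \<Sum>n<N. ?t m n)" by (rule sum.swap)
      also have "\<dots> \<le> wnorm {w} d"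
        unfolding rectangle by (rule sum_le_wnorm) auto
      finally show "(\<Sum>n<N. \<Sum>m<M. ?t m n) \<le> wnorm {w} d" .
    qed
    finally show "(\<Sum>m<M. suminf (\<lambda>n. ?t m n)) \<le> wnorm {w} d" .
  qed
  show "wnorm {w} d \<le> suminf (\<lambda>m. suminf (\<lambda>n. ?t m n))"
  proof (rule wnorm_leI)
    fix v and F :: "(nat \<times> nat) set" assume F: "v \<in> {w}" "finite F"
    define N where "N = Suc (Max (insert 0 (fst ` F \<union> snd ` F)))"
    have "F \<subseteq> {..<N} \<times> {..<N}"
    proof
      fix p assume "p \<in> F"
      then have "fst p \<le> Max (insert 0 (fst ` F \<union> snd ` F))" "snd p \<le> Max (insert 0 (fst ` F \<union> snd ` F))"
        using F(2) by (auto intro!: Max_ge)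
      then show "p \<in> {..<N} \<times> {..<N}" by (cases p) (simp add: N_def)
    qed
    then have "(\<Sum>p\<in>F. v p * \<bar>d p\<bar>) \<le> (\<Sum>p\<in>{..<N} \<times> {..<N}. w p * \<bar>d p\<bar>)"
      using F(1) assms by (simp add: sum_mono2)
    then have "ennreal (\<Sum>p\<in>F. v p * \<bar>d p\<bar>) \<le> (\<Sum>m<N. \<Sum>n<N. ?t m n)"
      unfolding rectangle by (rule ennreal_leI)
    also have "\<dots> \<le> (\<Sum>m<N. suminf (\<lambda>n. ?t m n))"
      by (intro sum_mono sum_le_suminf) auto
    also have "\<dots> \<le> suminf (\<lambda>m. suminf (\<lambda>n. ?t m n))"
      by (intro sum_le_suminf) auto
    finally show "ennreal (\<Sum>p\<in>F. v p * \<bar>d p\<bar>) \<le> suminf (\<lambda>m. suminf (\<lambda>n. ?t m n))" .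
  qed
qed

lemma wnorm_eq_SUP: "wnorm W d = (SUP w\<in>W. wnorm {w} d)"
proof (rule antisym)
  show "wnorm W d \<le> (SUP w\<in>W. wnorm {w} d)"
    by (rule wnorm_leI, rule SUP_upper2, assumption, rule sum_le_wnorm) auto
  show "(SUP w\<in>W. wnorm {w} d) \<le> wnorm W d"
    by (rule SUP_least, rule wnorm_leI) (auto intro: sum_le_wnorm)
qed

section \<open>The Besselian norm of an unconditional basis\<close>

text \<open>The weights \<open>m \<mapsto> \<bar>f (a m)\<bar>\<close>, for \<open>f\<close> in the unit ball of the dual space.\<close>
definition functional_weights :: "(nat \<Rightarrow> 'a::real_normed_vector) \<Rightarrow> (nat \<Rightarrow> real) set" where
  "functional_weights a = (\<lambda>f m. \<bar>blinfun_apply f (a m)\<bar>) ` {f :: 'a \<Rightarrow>\<^sub>L real. norm f \<le> 1}"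

lemma bess_norm_eq_wnorm: "bess_norm a b v = wnorm_real (functional_weights a) (\<lambda>m. blinfun_apply (b m) v)"
  unfolding bess_norm_def wnorm_real_def
  by (subst wnorm_eq_SUP)
    (simp add: functional_weights_def image_image wnorm_singleton_nat[symmetric] abs_mult mult.commute)

locale schauder_basis =
  fixes a :: "nat \<Rightarrow> 'a::banach" and b :: "nat \<Rightarrow> 'a \<Rightarrow>\<^sub>L real"
  assumes basis: "unconditional_schauder_basis a b"
begin

abbreviation coords :: "'a \<Rightarrow> nat \<Rightarrow> real" where "coords v \<equiv> (\<lambda>m. blinfun_apply (b m) v)"

lemma expansion: "(\<lambda>m. coords v m *\<^sub>R a m) sums v"
  using basis by (simp add: unconditional_schauder_basis_def)

lemma expansion_unique:
  assumes "(\<lambda>m. c m *\<^sub>R a m) sums v"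
  shows "coords v = c"
proof -
  have "\<exists>!c. (\<lambda>m. c m *\<^sub>R a m) sums v"
    using basis by (simp add: unconditional_schauder_basis_def)
  then obtain c0 where c0: "\<forall>c. (\<lambda>m. c m *\<^sub>R a m) sums v \<longrightarrow> c = c0"
    by (rule ex1E)
  have "coords v = c0" using c0[rule_format, OF expansion[of v]] .
  moreover have "c = c0" using c0[rule_format, OF assms] .
  ultimately show ?thesis by simp
qed

lemma biorthogonal: "blinfun_apply (b m) (a k) = (if m = k then 1 else 0)"
proof -
  have "(\<lambda>m. (if m = k then 1 else 0) *\<^sub>R a m) = (\<lambda>m. if m = k then a m else 0)" by auto
  then have "(\<lambda>m. (if m = k then 1 else 0) *\<^sub>R a m) sums a k"
    using sums_single[of k a] by simp
  from expansion_unique[OF this] show ?thesis by (simp add: fun_eq_iff)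
qed

lemma weight_family_functional_weights: "weight_family (functional_weights a)"
proof
  show "0 \<le> w m" if "w \<in> functional_weights a" for w m
    using that by (auto simp: functional_weights_def)
  show "\<exists>C. \<forall>w\<in>functional_weights a. w m \<le> C" for m
  proof (intro exI ballI)
    fix w assume "w \<in> functional_weights a"
    then obtain f :: "'a \<Rightarrow>\<^sub>L real" where f: "norm f \<le> 1" "w = (\<lambda>m. \<bar>blinfun_apply f (a m)\<bar>)"
      by (auto simp: functional_weights_def)
    have "\<bar>blinfun_apply f (a m)\<bar> \<le> norm f * norm (a m)"
      using norm_blinfun[of f "a m"] by simp
    also have "\<dots> \<le> 1 * norm (a m)" by (intro mult_right_mono f) simp
    finally show "w m \<le> norm (a m)" by (simp add: f)
  qed
  show "\<exists>w\<in>functional_weights a. 0 < w m" for m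
  proof -
    obtain f :: "'a \<Rightarrow>\<^sub>L real" where f: "norm f \<le> 1" "blinfun_apply f (a m) = norm (a m)"
      by (rule norming_functional)
    have "a m \<noteq> 0" using biorthogonal[of m m] by auto
    with f show ?thesis by (auto simp: functional_weights_def intro!: bexI[of _ f])
  qed
qed

sublocale weight_family "functional_weights a"
  by (rule weight_family_functional_weights)

text \<open>Far-out finite sums of the expansion are small in norm. Splitting them by the sign of
  \<open>coords v m * f (a m)\<close> bounds the absolute sums, uniformly in \<open>f\<close>.\<close>
lemma coords_in_wspace: "coords v \<in> wspace (functional_weights a)"
  unfolding wspace_def
proof (intro CollectI allI impI)
  fix \<epsilon> :: real assume "0 < \<epsilon>"
  have "\<And>\<pi>. bij \<pi> \<Longrightarrow> summable (\<lambda>m. coords v (\<pi> m) *\<^sub>R a (\<pi> m))"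
    using basis by (simp add: unconditional_schauder_basis_def)
  then obtain M where M: "\<And>F. finite F \<Longrightarrow> F \<subseteq> {M..} \<Longrightarrow> norm (\<Sum>m\<in>F. coords v m *\<^sub>R a m) < \<epsilon>/2"
    using unconditional_tail[of "\<lambda>m. coords v m *\<^sub>R a m" "\<epsilon>/2"] \<open>0 < \<epsilon>\<close> by auto
  have "wnorm (functional_weights a) (\<lambda>m. if m \<in> {..<M} then 0 else coords v m) \<le> ennreal \<epsilon>"
  proof (intro wnorm_leI ennreal_leI)
    fix w and F :: "nat set" assume w: "w \<in> functional_weights a" and F: "finite F"
    obtain f :: "'a \<Rightarrow>\<^sub>L real" where f: "norm f \<le> 1" "w = (\<lambda>m. \<bar>blinfun_apply f (a m)\<bar>)"
      using w by (auto simp: functional_weights_def)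
    let ?t = "\<lambda>m. coords v m * blinfun_apply f (a m)"
    have small: "\<bar>\<Sum>m\<in>G. ?t m\<bar> \<le> \<epsilon>/2" if G: "finite G" "G \<subseteq> {M..}" for G
    proof -
      have "(\<Sum>m\<in>G. ?t m) = blinfun_apply f (\<Sum>m\<in>G. coords v m *\<^sub>R a m)"
        by (simp add: blinfun.sum_right blinfun.scaleR_right)
      moreover have "norm (blinfun_apply f (\<Sum>m\<in>G. coords v m *\<^sub>R a m))
          \<le> norm f * norm (\<Sum>m\<in>G. coords v m *\<^sub>R a m)"
        by (rule norm_blinfun)
      moreover have "\<dots> \<le> 1 * norm (\<Sum>m\<in>G. coords v m *\<^sub>R a m)"
        by (intro mult_right_mono f) simp
      ultimately show ?thesis using M[OF G] by simp
    qed
    have half: "\<bar>\<Sum>m\<in>{m \<in> F \<inter> {M..}. Q m}. ?t m\<bar> \<le> \<epsilon>/2" for Q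
      by (rule small) (use F in auto)
    let ?F = "F \<inter> {M..}"
    let ?P = "{m \<in> ?F. 0 \<le> ?t m}" and ?N = "{m \<in> ?F. \<not> 0 \<le> ?t m}"
    have "(\<Sum>m\<in>F. w m * \<bar>if m \<in> {..<M} then 0 else coords v m\<bar>) = (\<Sum>m\<in>?F. \<bar>?t m\<bar>)"
      by (rule sum.mono_neutral_cong_right) (use F in \<open>auto simp: f abs_mult\<close>)
    also have "\<dots> = (\<Sum>m\<in>?P \<union> ?N. \<bar>?t m\<bar>)"
      by (rule sum.cong) auto
    also have "\<dots> = (\<Sum>m\<in>?P. \<bar>?t m\<bar>) + (\<Sum>m\<in>?N. \<bar>?t m\<bar>)"
      by (rule sum.union_disjoint) (use F in auto)
    also have "(\<Sum>m\<in>?P. \<bar>?t m\<bar>) = (\<Sum>m\<in>?P. ?t m)"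
      by (rule sum.cong) auto
    also have "(\<Sum>m\<in>?N. \<bar>?t m\<bar>) = - (\<Sum>m\<in>?N. ?t m)"
      unfolding sum_negf[symmetric] by (rule sum.cong) auto
    finally show "(\<Sum>m\<in>F. w m * \<bar>if m \<in> {..<M} then 0 else coords v m\<bar>) \<le> \<epsilon>"
      using half[of "\<lambda>m. 0 \<le> ?t m"] half[of "\<lambda>m. \<not> 0 \<le> ?t m"] by linarith
  qed
  then show "\<exists>F. finite F \<and> wnorm (functional_weights a) (\<lambda>m. if m \<in> F then 0 else coords v m) \<le> ennreal \<epsilon>"
    by (intro exI[of _ "{..<M}"]) simp
qed

text \<open>Conversely, the norm of a block of the series is attained by a functional of norm at most
  one, so that it is at most the tail of \<open>d\<close> in \<^const>\<open>wnorm\<close>.\<close>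
lemma summable_of_wspace:
  assumes d: "d \<in> wspace (functional_weights a)"
  shows "summable (\<lambda>m. d m *\<^sub>R a m)"
  unfolding summable_Cauchy
proof (intro allI impI)
  fix \<epsilon> :: real assume "0 < \<epsilon>"
  then have "0 < \<epsilon>/2" by simp
  obtain F where F: "finite F" "wnorm (functional_weights a) (\<lambda>m. if m \<in> F then 0 else d m) \<le> ennreal (\<epsilon>/2)"
    by (rule wspaceD[OF d \<open>0 < \<epsilon>/2\<close>])
  obtain M where M: "F \<subseteq> {..<M}" using finite_nat_iff_bounded F(1) by blast
  have "norm (\<Sum>m\<in>{k..<n}. d m *\<^sub>R a m) < \<epsilon>" if "M \<le> k" for k n
  proof -
    obtain f :: "'a \<Rightarrow>\<^sub>L real" where f: "norm f \<le> 1"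
        "blinfun_apply f (\<Sum>m\<in>{k..<n}. d m *\<^sub>R a m) = norm (\<Sum>m\<in>{k..<n}. d m *\<^sub>R a m)"
      by (rule norming_functional)
    let ?w = "\<lambda>m. \<bar>blinfun_apply f (a m)\<bar>"
    have w: "?w \<in> functional_weights a" using f(1) by (auto simp: functional_weights_def)
    have "norm (\<Sum>m\<in>{k..<n}. d m *\<^sub>R a m) = (\<Sum>m\<in>{k..<n}. d m * blinfun_apply f (a m))"
      unfolding f(2)[symmetric] by (simp add: blinfun.sum_right blinfun.scaleR_right)
    also have "\<dots> \<le> (\<Sum>m\<in>{k..<n}. ?w m * \<bar>if m \<in> F then 0 else d m\<bar>)"
    proof (rule sum_mono)
      fix m assume "m \<in> {k..<n}"
      then have "m \<notin> F" using M that by auto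
      then show "d m * blinfun_apply f (a m) \<le> ?w m * \<bar>if m \<in> F then 0 else d m\<bar>"
        using abs_ge_self[of "d m * blinfun_apply f (a m)"] by (simp add: abs_mult mult.commute)
    qed
    finally have "ennreal (norm (\<Sum>m\<in>{k..<n}. d m *\<^sub>R a m)) \<le> ennreal (\<epsilon>/2)"
      using sum_le_wnorm[OF w, of "{k..<n}" "\<lambda>m. if m \<in> F then 0 else d m"] F(2)
      by (meson ennreal_leI finite_atLeastLessThan order_trans)
    then show ?thesis using \<open>0 < \<epsilon>\<close> by (simp add: ennreal_le_iff)
  qed
  then show "\<exists>N. \<forall>m\<ge>N. \<forall>n. norm (\<Sum>m\<in>{m..<n}. d m *\<^sub>R a m) < \<epsilon>" by blast
qed

lemma banach_lattice_renormed: "\<exists>leq. banach_lattice (renormed (bess_norm a b)) leq"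
proof (rule banach_lattice_transport)
  let ?\<psi> = "\<lambda>d. suminf (\<lambda>m. d m *\<^sub>R a m)"
  have coords_series: "coords (?\<psi> d) = d" if "d \<in> wspace (functional_weights a)" for d
    by (rule expansion_unique[OF summable_sums[OF summable_of_wspace[OF that]]])
  have series_coords: "?\<psi> (coords v) = v" for v
    using expansion[of v] by (rule sums_unique[symmetric])
  have "bij_betw ?\<psi> (wspace (functional_weights a)) UNIV"
    by (rule bij_betwI[where g = coords]) (use coords_series series_coords coords_in_wspace in auto)
  then show "bij_betw ?\<psi> (wspace (functional_weights a)) (carrier (renormed (bess_norm a b)))"
    by (simp add: renormed_def)
  show "?\<psi> (\<lambda>m. 0) = \<zero>\<^bsub>renormed (bess_norm a b)\<^esub>"
    by (simp add: renormed_def)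
  fix d assume d: "d \<in> wspace (functional_weights a)"
  note sum_d = summable_of_wspace[OF d]
  show "c \<odot>\<^bsub>renormed (bess_norm a b)\<^esub> ?\<psi> d = ?\<psi> (\<lambda>i. c * d i)" for c
    using suminf_scaleR_right[OF sum_d, of c] by (simp add: renormed_def)
  show "vnorm (renormed (bess_norm a b)) (?\<psi> d) = wnorm_real (functional_weights a) d"
    using coords_series[OF d] by (simp add: renormed_def bess_norm_eq_wnorm)
  show "?\<psi> d \<oplus>\<^bsub>renormed (bess_norm a b)\<^esub> ?\<psi> e = ?\<psi> (\<lambda>i. d i + e i)"
    if "e \<in> wspace (functional_weights a)" for e
    using suminf_add[OF sum_d summable_of_wspace[OF that]]
    by (simp add: renormed_def scaleR_add_left)
qed

end

section \<open>Products of weights\<close>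

text \<open>All products of a weight from \<open>W\<close> with a weight from \<open>Z\<close>.\<close>
definition product_weights :: "('i \<Rightarrow> real) set \<Rightarrow> ('j \<Rightarrow> real) set \<Rightarrow> ('i \<times> 'j \<Rightarrow> real) set" where
  "product_weights W Z = (\<lambda>(w, z) p. w (fst p) * z (snd p)) ` (W \<times> Z)"

lemma weight_family_product_weights:
  assumes "weight_family W" "weight_family Z"
  shows "weight_family (product_weights W Z)"
proof -
  interpret W: weight_family W by fact
  interpret Z: weight_family Z by fact
  show ?thesis
  proof
    show "0 \<le> \<omega> p" if "\<omega> \<in> product_weights W Z" for \<omega> p
      using that by (auto simp: product_weights_def W.nonneg Z.nonneg)
    show "\<exists>C. \<forall>\<omega>\<in>product_weights W Z. \<omega> p \<le> C" for p
    proof -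
      obtain C D where C: "\<And>w. w \<in> W \<Longrightarrow> w (fst p) \<le> C" and D: "\<And>z. z \<in> Z \<Longrightarrow> z (snd p) \<le> D"
        using W.bounded[of "fst p"] Z.bounded[of "snd p"] by blast
      have "w (fst p) * z (snd p) \<le> C * D" if "w \<in> W" "z \<in> Z" for w z
        using that C D W.nonneg[OF that(1)] Z.nonneg[OF that(2)]
        by (intro mult_mono) (auto intro: order_trans[OF W.nonneg[OF that(1)] C])
      then show ?thesis by (auto simp: product_weights_def)
    qed
    show "\<exists>\<omega>\<in>product_weights W Z. 0 < \<omega> p" for p
    proof -
      obtain w z where "w \<in> W" "0 < w (fst p)" "z \<in> Z" "0 < z (snd p)"
        using W.positive[of "fst p"] Z.positive[of "snd p"] by blast
      then show ?thesis by (force simp: product_weights_def)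
    qed
  qed
qed

lemma wnorm_product_le:
  assumes "nonneg_weights W" "nonneg_weights Z"
  shows "wnorm (product_weights W Z) (\<lambda>p. d (fst p) * e (snd p)) \<le> wnorm W d * wnorm Z e"
proof (rule wnorm_leI)
  interpret W: nonneg_weights W by fact
  interpret Z: nonneg_weights Z by fact
  fix \<omega> and F :: "('a \<times> 'b) set" assume "\<omega> \<in> product_weights W Z" and F: "finite F"
  then obtain w z where w: "w \<in> W" and z: "z \<in> Z" and \<omega>: "\<omega> = (\<lambda>p. w (fst p) * z (snd p))"
    by (auto simp: product_weights_def)
  let ?s = "\<Sum>i\<in>fst ` F. w i * \<bar>d i\<bar>" and ?t = "\<Sum>j\<in>snd ` F. z j * \<bar>e j\<bar>"
  have "(\<Sum>p\<in>F. \<omega> p * \<bar>d (fst p) * e (snd p)\<bar>)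
      \<le> (\<Sum>p\<in>fst ` F \<times> snd ` F. \<omega> p * \<bar>d (fst p) * e (snd p)\<bar>)"
    using F by (intro sum_mono2 subset_fst_snd) (auto simp: \<omega> W.nonneg[OF w] Z.nonneg[OF z])
  also have "\<dots> = ?s * ?t"
    by (simp add: sum_product sum.cartesian_product case_prod_unfold \<omega> abs_mult algebra_simps)
  finally have "ennreal (\<Sum>p\<in>F. \<omega> p * \<bar>d (fst p) * e (snd p)\<bar>) \<le> ennreal ?s * ennreal ?t"
    by (simp add: ennreal_mult[symmetric] W.weighted_sum_nonneg[OF w] Z.weighted_sum_nonneg[OF z] ennreal_leI)
  also have "\<dots> \<le> wnorm W d * wnorm Z e"
    using F by (intro mult_mono sum_le_wnorm w z) auto
  finally show "ennreal (\<Sum>p\<in>F. \<omega> p * \<bar>d (fst p) * e (snd p)\<bar>) \<le> wnorm W d * wnorm Z e" .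
qed

section \<open>Linear functionals on the tensor product\<close>

text \<open>The linear functional on the free vector space that extends \<open>\<beta>\<close>.\<close>
definition free_extension :: "('a \<Rightarrow> 'b \<Rightarrow> real) \<Rightarrow> ('a \<times> 'b \<Rightarrow>\<^sub>0 real) \<Rightarrow> real" where
  "free_extension \<beta> p = (\<Sum>k\<in>Poly_Mapping.keys p. poly_mapping.lookup p k * \<beta> (fst k) (snd k))"

lemma free_extension_superset:
  assumes "finite K" "Poly_Mapping.keys p \<subseteq> K"
  shows "free_extension \<beta> p = (\<Sum>k\<in>K. poly_mapping.lookup p k * \<beta> (fst k) (snd k))"
  unfolding free_extension_def
  by (rule sum.mono_neutral_left) (use assms in \<open>auto simp: in_keys_iff\<close>)

lemma linear_free_extension: "linear (free_extension \<beta>)"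
proof (rule linearI)
  fix p q :: "'a \<times> 'b \<Rightarrow>\<^sub>0 real" and c :: real
  let ?K = "Poly_Mapping.keys p \<union> Poly_Mapping.keys q"
  have K: "finite ?K" "Poly_Mapping.keys p \<subseteq> ?K" "Poly_Mapping.keys q \<subseteq> ?K" "Poly_Mapping.keys (p + q) \<subseteq> ?K"
    using keys_add[of p q] by auto
  show "free_extension \<beta> (p + q) = free_extension \<beta> p + free_extension \<beta> q"
    unfolding free_extension_superset[OF K(1,2)] free_extension_superset[OF K(1,3)]
      free_extension_superset[OF K(1,4)]
    by (simp add: lookup_add distrib_right sum.distrib)
  have lookup: "poly_mapping.lookup (c *\<^sub>R p) k = c * poly_mapping.lookup p k" for k
    by transfer simp
  then have "Poly_Mapping.keys (c *\<^sub>R p) \<subseteq> Poly_Mapping.keys p" by (auto simp: in_keys_iff)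
  from free_extension_superset[OF finite_keys this]
  show "free_extension \<beta> (c *\<^sub>R p) = c *\<^sub>R free_extension \<beta> p"
    by (simp add: lookup free_extension_def sum_distrib_left mult.assoc)
qed

lemma free_extension_free_elem [simp]: "free_extension \<beta> (free_elem v w) = \<beta> v w"
  by (simp add: free_extension_def free_elem_def)

lemma free_extension_span_eq_0:
  assumes "bilinear \<beta>" "p \<in> span bilinearity_relations"
  shows "free_extension \<beta> p = 0"
proof -
  interpret linear "free_extension \<beta>" by (rule linear_free_extension)
  have "free_extension \<beta> r = 0" if "r \<in> bilinearity_relations" for r
    using that assms(1) unfolding bilinearity_relations_def
    by (auto simp: diff scale bilinear_ladd bilinear_radd bilinear_lmul bilinear_rmul)
  then show ?thesis using assms(2) by (rule linear_eq_0_on_span[OF linear_free_extension])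
qed

text \<open>The linear functional on the tensor product that a bilinear \<open>\<beta>\<close> induces. It is evaluated on a
  chosen representative; for bilinear \<open>\<beta>\<close> the choice does not matter.\<close>
definition bilinear_extension ::
    "('a::real_vector \<Rightarrow> 'b::real_vector \<Rightarrow> real) \<Rightarrow> ('a, 'b) tensor_product \<Rightarrow> real" where
  "bilinear_extension \<beta> u = free_extension \<beta> (rep_tensor_product u)"

lemma bilinear_extension_abs:
  assumes "bilinear \<beta>"
  shows "bilinear_extension \<beta> (abs_tensor_product p) = free_extension \<beta> p"
proof -
  interpret linear "free_extension \<beta>" by (rule linear_free_extension)
  have "abs_tensor_product (rep_tensor_product (abs_tensor_product p)) = abs_tensor_product p"
    using Quotient_tensor_product by (rule Quotient_abs_rep)
  then have "rep_tensor_product (abs_tensor_product p) - p \<in> span bilinearity_relations"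
    by (simp add: tensor_product.abs_eq_iff)
  from free_extension_span_eq_0[OF assms this] show ?thesis
    by (simp add: bilinear_extension_def diff)
qed

lemma abs_tensor_product_cases: obtains p where "u = abs_tensor_product p"
  using Quotient_abs_rep[OF Quotient_tensor_product, of u] by metis

lemma linear_bilinear_extension:
  assumes "bilinear \<beta>"
  shows "linear (bilinear_extension \<beta>)"
proof (rule linearI)
  interpret linear "free_extension \<beta>" by (rule linear_free_extension)
  fix u v :: "('a, 'b) tensor_product" and c :: real
  obtain p q where "u = abs_tensor_product p" "v = abs_tensor_product q"
    by (metis abs_tensor_product_cases)
  then show "bilinear_extension \<beta> (u + v) = bilinear_extension \<beta> u + bilinear_extension \<beta> v"
    and "bilinear_extension \<beta> (c *\<^sub>R u) = c *\<^sub>R bilinear_extension \<beta> u"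
    by (simp_all add: plus_tensor_product.abs_eq scaleR_tensor_product.abs_eq
        bilinear_extension_abs[OF assms] add scale)
qed

lemma bilinear_extension_tensor:
  "bilinear \<beta> \<Longrightarrow> bilinear_extension \<beta> (tensor v w) = \<beta> v w"
  by (simp add: tensor.abs_eq bilinear_extension_abs)

lemma tensor_product_sum_list:
  obtains ts where "u = (\<Sum>(v, w)\<leftarrow>ts. tensor v w)"
proof -
  obtain p where u: "u = abs_tensor_product p" by (rule abs_tensor_product_cases)
  have "\<exists>ts. abs_tensor_product p = (\<Sum>(v, w)\<leftarrow>ts. tensor v w)"
  proof (induction p rule: update_induct)
    case const
    show ?case by (rule exI[of _ "[]"]) (simp add: zero_tensor_product_def)
  next
    case (update p k c)
    then obtain ts where ts: "abs_tensor_product p = (\<Sum>(v, w)\<leftarrow>ts. tensor v w)" by blast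
    have "Poly_Mapping.update k c p = c *\<^sub>R free_elem (fst k) (snd k) + p"
      using update(1)
      by (intro poly_mapping_eqI)
        (auto simp: free_elem_def lookup_update lookup_add lookup_single scaleR_poly_mapping.rep_eq
          in_keys_iff when_def)
    then have "abs_tensor_product (Poly_Mapping.update k c p)
        = tensor (c *\<^sub>R fst k) (snd k) + abs_tensor_product p"
      by (simp add: plus_tensor_product.abs_eq[symmetric] scaleR_tensor_product.abs_eq[symmetric]
          tensor.abs_eq[symmetric] tensor_scaleR_left)
    with ts show ?case by (intro exI[of _ "(c *\<^sub>R fst k, snd k) # ts"]) simp
  qed
  with u that show ?thesis by blast
qed

section \<open>The Besselian crossnorm\<close>

locale schauder_basis_pair = E: schauder_basis a b + F: schauder_basis x y
  for a :: "nat \<Rightarrow> 'a::banach" and b and x :: "nat \<Rightarrow> 'b::banach" and y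
begin

text \<open>The weights \<open>(m, n) \<mapsto> \<bar>f (a m)\<bar> * \<bar>g (x n)\<bar>\<close>, for \<open>f\<close> and \<open>g\<close> in the dual unit balls.\<close>
definition weights :: "(nat \<times> nat \<Rightarrow> real) set" where
  "weights = product_weights (functional_weights a) (functional_weights x)"

sublocale P: weight_family weights
  unfolding weights_def
  by (rule weight_family_product_weights[OF E.weight_family_functional_weights
        F.weight_family_functional_weights])

text \<open>The matrix of coefficients of a tensor with respect to the two bases.\<close>
definition coef :: "('a, 'b) tensor_product \<Rightarrow> nat \<times> nat \<Rightarrow> real" where
  "coef u p = bilinear_extension (\<lambda>v w. E.coords v (fst p) * F.coords w (snd p)) u"

text \<open>The elementary tensors of basis vectors.\<close>
definition basic :: "nat \<times> nat \<Rightarrow> ('a, 'b) tensor_product" where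
  "basic p = tensor (a (fst p)) (x (snd p))"

lemma bilinear_coords: "bilinear (\<lambda>v w. E.coords v m * F.coords w n)"
  unfolding bilinear_def
  by (auto intro!: linearI simp: blinfun.add_right blinfun.scaleR_right algebra_simps)

lemma linear_coef: "linear (\<lambda>u. coef u p)"
  unfolding coef_def by (rule linear_bilinear_extension[OF bilinear_coords])

lemmas coef_add = linear_add[OF linear_coef]
  and coef_diff = linear_diff[OF linear_coef]
  and coef_scale = linear_scale[OF linear_coef]
  and coef_sum = linear_sum[OF linear_coef]
  and coef_0 = linear_0[OF linear_coef]

lemma coef_tensor: "coef (tensor v w) p = E.coords v (fst p) * F.coords w (snd p)"
  unfolding coef_def by (rule bilinear_extension_tensor[OF bilinear_coords])

lemma coef_basic: "coef (basic q) p = (if p = q then 1 else 0)"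
  by (auto simp: basic_def coef_tensor E.biorthogonal F.biorthogonal prod_eq_iff)

lemma nonneg_weights_singleton: "\<omega> \<in> weights \<Longrightarrow> nonneg_weights {\<omega>}"
  using P.nonneg by unfold_locales auto

lemma bess_eq:
  "bess a b x y ts = (SUP \<omega>\<in>weights. \<Sum>(v, w)\<leftarrow>ts. wnorm {\<omega>} (coef (tensor v w)))"
proof -
  let ?B = "{f :: 'a \<Rightarrow>\<^sub>L real. norm f \<le> 1} \<times> {g :: 'b \<Rightarrow>\<^sub>L real. norm g \<le> 1}"
  define K :: "('a \<Rightarrow>\<^sub>L real) \<times> ('b \<Rightarrow>\<^sub>L real) \<Rightarrow> nat \<times> nat \<Rightarrow> real" where
    "K q p = \<bar>blinfun_apply (fst q) (a (fst p))\<bar> * \<bar>blinfun_apply (snd q) (x (snd p))\<bar>" for q p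
  have weights: "weights = K ` ?B"
    unfolding weights_def product_weights_def functional_weights_def K_def[abs_def]
    by (force simp: image_iff)
  have summand: "suminf (\<lambda>m. suminf (\<lambda>n.
          ennreal \<bar>b m v * y n w * blinfun_apply f (a m) * blinfun_apply g (x n)\<bar>))
      = wnorm {K (f, g)} (coef (tensor v w))" for f g v w
  proof -
    have nonneg: "0 \<le> K (f, g) p" for p by (simp add: K_def)
    have term_eq: "ennreal \<bar>b m v * y n w * blinfun_apply f (a m) * blinfun_apply g (x n)\<bar>
        = ennreal (K (f, g) (m, n) * \<bar>coef (tensor v w) (m, n)\<bar>)" for m n
      by (simp add: K_def coef_tensor abs_mult algebra_simps)
    show ?thesis
      unfolding term_eq by (rule wnorm_singleton_nat_prod[OF nonneg])
  qed
  show ?thesis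
    unfolding bess_def weights summand by (simp add: image_image case_prod_unfold)
qed

lemma bess_append: "bess a b x y (ts @ us) \<le> bess a b x y ts + bess a b x y us"
  unfolding bess_eq by (rule SUP_least) (auto intro!: add_mono SUP_upper)

lemma bess_tensor_le:
  "bess a b x y [(v, w)]
    \<le> wnorm (functional_weights a) (E.coords v) * wnorm (functional_weights x) (F.coords w)"
proof -
  have "bess a b x y [(v, w)] = wnorm weights (\<lambda>p. E.coords v (fst p) * F.coords w (snd p))"
    by (subst wnorm_eq_SUP) (simp add: bess_eq coef_tensor[abs_def])
  also have "\<dots> \<le> wnorm (functional_weights a) (E.coords v) * wnorm (functional_weights x) (F.coords w)"
    unfolding weights_def by (rule wnorm_product_le) unfold_locales
  finally show ?thesis .
qed

text \<open>The triangle inequality inside each weighted sum: every representation of \<open>u\<close> costs at least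
  the norm of its coefficient matrix.\<close>
lemma wnorm_coef_le_bess:
  assumes "u = (\<Sum>(v, w)\<leftarrow>ts. tensor v w)"
  shows "wnorm weights (coef u) \<le> bess a b x y ts"
proof -
  have "wnorm {\<omega>} (coef u) \<le> (\<Sum>(v, w)\<leftarrow>ts. wnorm {\<omega>} (coef (tensor v w)))" if \<omega>: "\<omega> \<in> weights" for \<omega>
    using assms
  proof (induction ts arbitrary: u)
    case Nil
    then show ?case using nonneg_weights.wnorm_zero[OF nonneg_weights_singleton[OF \<omega>]]
      by (simp add: coef_0[abs_def])
  next
    case (Cons t ts)
    let ?u = "\<Sum>(v, w)\<leftarrow>ts. tensor v w"
    obtain v w where t: "t = (v, w)" by fastforce
    have "coef u = (\<lambda>p. coef (tensor v w) p + coef ?u p)"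
      using Cons.prems by (simp add: t coef_add fun_eq_iff)
    then have "wnorm {\<omega>} (coef u) \<le> wnorm {\<omega>} (coef (tensor v w)) + wnorm {\<omega>} (coef ?u)"
      using nonneg_weights.wnorm_add[OF nonneg_weights_singleton[OF \<omega>]] by simp
    also have "\<dots> \<le> wnorm {\<omega>} (coef (tensor v w)) + (\<Sum>(v, w)\<leftarrow>ts. wnorm {\<omega>} (coef (tensor v w)))"
      by (intro add_left_mono Cons.IH refl)
    finally show ?case by (simp add: t)
  qed
  then show ?thesis
    unfolding wnorm_eq_SUP[of weights] bess_eq by (intro SUP_mono) blast
qed

lemma span_basic_coef:
  assumes "u \<in> span (range basic)"
  obtains H where "finite H" "\<And>p. p \<notin> H \<Longrightarrow> coef u p = 0" "u = (\<Sum>p\<in>H. coef u p *\<^sub>R basic p)"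
proof -
  obtain T c where T: "finite T" "T \<subseteq> range basic" "u = (\<Sum>t\<in>T. c t *\<^sub>R t)"
    using assms unfolding span_explicit by blast
  have inj: "inj basic"
  proof (rule injI)
    fix p q assume "basic p = basic q"
    then have "coef (basic q) p = 1" using coef_basic[of p p] by simp
    then show "p = q" by (simp add: coef_basic split: if_splits)
  qed
  define H where "H = basic -` T"
  have H: "finite H" "T = basic ` H"
    using T(1,2) inj by (auto simp: H_def intro: finite_vimageI)
  have u: "u = (\<Sum>p\<in>H. c (basic p) *\<^sub>R basic p)"
    using T(3) inj by (simp add: H(2) sum.reindex inj_on_subset)
  have coef: "coef u p = (if p \<in> H then c (basic p) else 0)" for p
    unfolding u coef_sum coef_scale coef_basic using H(1) by (simp add: if_distrib cong: if_cong)
  show ?thesis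
    by (rule that[OF H(1)]) (simp_all add: coef, subst u, rule sum.cong, simp_all)
qed

text \<open>For a tensor with finitely many nonzero coefficients this bound is attained by its expansion in
  basis tensors, since the summands have disjoint supports.\<close>
lemma bess_span_basic:
  assumes "u \<in> span (range basic)"
  obtains ts where "u = (\<Sum>(v, w)\<leftarrow>ts. tensor v w)" "bess a b x y ts \<le> wnorm weights (coef u)"
proof -
  obtain H where H: "finite H" "\<And>p. p \<notin> H \<Longrightarrow> coef u p = 0" "u = (\<Sum>p\<in>H. coef u p *\<^sub>R basic p)"
    by (rule span_basic_coef[OF assms]) blast
  obtain l where l: "set l = H" "distinct l" using finite_distinct_list[OF H(1)] by blast
  let ?t = "\<lambda>p. (coef u p *\<^sub>R a (fst p), x (snd p))"
  have tensor: "tensor (coef u p *\<^sub>R a (fst p)) (x (snd p)) = coef u p *\<^sub>R basic p" for p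
    by (simp add: basic_def tensor_scaleR_left)
  have list: "sum_list (map h l) = (\<Sum>p\<in>H. h p)" for h :: "nat \<times> nat \<Rightarrow> 'c::comm_monoid_add"
    using l by (simp add: sum_list_distinct_conv_sum_set)
  show ?thesis
  proof (rule that[of "map ?t l"])
    show "u = (\<Sum>(v, w)\<leftarrow>map ?t l. tensor v w)"
      using H(3) by (simp add: comp_def list tensor)
    show "bess a b x y (map ?t l) \<le> wnorm weights (coef u)"
      unfolding bess_eq
    proof (rule SUP_least)
      fix \<omega> assume \<omega>: "\<omega> \<in> weights"
      have single: "wnorm {\<omega>} (coef (coef u p *\<^sub>R basic p)) \<le> ennreal (\<omega> p * \<bar>coef u p\<bar>)" for p
      proof (intro wnorm_leI ennreal_leI)
        fix \<omega>' and G :: "(nat \<times> nat) set" assume \<omega>': "\<omega>' \<in> {\<omega>}" and G: "finite G"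
        have "(\<Sum>q\<in>G. \<omega>' q * \<bar>coef (coef u p *\<^sub>R basic p) q\<bar>)
            = (\<Sum>q\<in>G. if q = p then \<omega> p * \<bar>coef u p\<bar> else 0)"
          using \<omega>' by (intro sum.cong) (auto simp: coef_scale coef_basic)
        also have "\<dots> \<le> \<omega> p * \<bar>coef u p\<bar>"
          using G P.nonneg[OF \<omega>, of p] by simp
        finally show "(\<Sum>q\<in>G. \<omega>' q * \<bar>coef (coef u p *\<^sub>R basic p) q\<bar>) \<le> \<omega> p * \<bar>coef u p\<bar>" .
      qed
      have "(\<Sum>(v, w)\<leftarrow>map ?t l. wnorm {\<omega>} (coef (tensor v w)))
          = (\<Sum>p\<in>H. wnorm {\<omega>} (coef (coef u p *\<^sub>R basic p)))"
        by (simp add: comp_def list tensor)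
      also have "\<dots> \<le> (\<Sum>p\<in>H. ennreal (\<omega> p * \<bar>coef u p\<bar>))"
        by (intro sum_mono single)
      also have "\<dots> = ennreal (\<Sum>p\<in>H. \<omega> p * \<bar>coef u p\<bar>)"
        by (rule sum_ennreal) (simp add: P.nonneg[OF \<omega>])
      also have "\<dots> \<le> wnorm weights (coef u)"
        by (rule sum_le_wnorm[OF \<omega> H(1)])
      finally show "(\<Sum>(v, w)\<leftarrow>map ?t l. wnorm {\<omega>} (coef (tensor v w))) \<le> wnorm weights (coef u)" .
    qed
  qed
qed

lemma tensor_mem_span_basic:
  assumes "v \<in> span (range a)" "w \<in> span (range x)"
  shows "tensor v w \<in> span (range basic)"
proof -
  have ax: "tensor (a m) (x n) \<in> span (range basic)" for m n
    by (rule span_base) (auto simp: basic_def intro: image_eqI[of _ _ "(m, n)"])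
  have lin: "linear (tensor v)" "linear (\<lambda>v. tensor v w)" for v :: 'a and w :: 'b
    by (auto intro!: linearI simp: tensor_add_left tensor_add_right tensor_scaleR_left tensor_scaleR_right)
  have "tensor (a m) w \<in> span (range basic)" for m
    using assms(2)
    by (induction w rule: span_induct_alt)
      (use ax in \<open>auto simp: linear_0[OF lin(1)] tensor_add_right tensor_scaleR_right intro!: span_zero span_add span_scale\<close>)
  note aw = this
  show ?thesis
    using assms(1)
    by (induction v rule: span_induct_alt)
      (use aw in \<open>auto simp: linear_0[OF lin(2)] tensor_add_left tensor_scaleR_left intro!: span_zero span_add span_scale\<close>)
qed
end

context schauder_basis
begin

text \<open>Truncated expansions approximate \<open>v\<close> in the Besselian norm and do not increase it.\<close>
lemma span_approximation:
  assumes "0 < \<epsilon>"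
  obtains v' where "v' \<in> span (range a)" "wnorm (functional_weights a) (coords (v - v')) \<le> ennreal \<epsilon>"
    "wnorm (functional_weights a) (coords v') \<le> wnorm (functional_weights a) (coords v)"
proof -
  obtain F where F: "finite F"
      "wnorm (functional_weights a) (\<lambda>m. if m \<in> F then 0 else coords v m) \<le> ennreal \<epsilon>"
    by (rule wspaceD[OF coords_in_wspace assms])
  let ?v = "\<Sum>m\<in>F. coords v m *\<^sub>R a m"
  have coords: "coords ?v m = (if m \<in> F then coords v m else 0)" for m
    using F(1) by (simp add: blinfun.sum_right blinfun.scaleR_right biorthogonal if_distrib cong: if_cong)
  have "?v \<in> span (range a)" by (intro span_sum span_scale span_base) auto
  moreover have "coords (v - ?v) = (\<lambda>m. if m \<in> F then 0 else coords v m)"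
    by (auto simp: blinfun.diff_right coords)
  moreover have "wnorm (functional_weights a) (coords ?v) \<le> wnorm (functional_weights a) (coords v)"
    by (rule wnorm_mono) (simp add: coords)
  ultimately show ?thesis using F(2) that[of ?v] by simp
qed

end

context schauder_basis_pair
begin

text \<open>Truncating both factors, with
  \<open>v \<otimes> w - v' \<otimes> w' = (v - v') \<otimes> w + v' \<otimes> (w - w')\<close>.\<close>
lemma bess_approximation_tensor:
  assumes "0 < \<epsilon>"
  obtains u' us where "u' \<in> span (range basic)" "tensor v w - u' = (\<Sum>(v, w)\<leftarrow>us. tensor v w)"
    "bess a b x y us \<le> ennreal \<epsilon>"
proof -
  let ?N = "\<lambda>v. wnorm (functional_weights a) (E.coords v)"
  let ?M = "\<lambda>w. wnorm (functional_weights x) (F.coords w)"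
  obtain A B where A: "0 \<le> A" "?N v = ennreal A" and B: "0 \<le> B" "?M w = ennreal B"
    using E.ennreal_wnorm_real[OF E.coords_in_wspace, of v] E.wnorm_real_nonneg
      F.ennreal_wnorm_real[OF F.coords_in_wspace, of w] F.wnorm_real_nonneg by metis
  define \<delta> where "\<delta> = \<epsilon> / (A + B + 1)"
  have "0 < \<delta>" using A B assms by (simp add: \<delta>_def)
  obtain v' where v': "v' \<in> span (range a)" "?N (v - v') \<le> ennreal \<delta>" "?N v' \<le> ?N v"
    by (rule E.span_approximation[OF \<open>0 < \<delta>\<close>])
  obtain w' where w': "w' \<in> span (range x)" "?M (w - w') \<le> ennreal \<delta>" "?M w' \<le> ?M w"
    by (rule F.span_approximation[OF \<open>0 < \<delta>\<close>])
  show ?thesis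
  proof (rule that)
    show "tensor v' w' \<in> span (range basic)"
      by (rule tensor_mem_span_basic[OF v'(1) w'(1)])
    have left: "tensor (v - v') w = tensor v w - tensor v' w"
      using tensor_add_left[of "v - v'" v' w] by simp
    have right: "tensor v' (w - w') = tensor v' w - tensor v' w'"
      using tensor_add_right[of v' "w - w'" w'] by simp
    show "tensor v w - tensor v' w' = (\<Sum>(v, w)\<leftarrow>[(v - v', w), (v', w - w')]. tensor v w)"
      by (simp add: left right)
    have "bess a b x y ([(v - v', w)] @ [(v', w - w')])
        \<le> bess a b x y [(v - v', w)] + bess a b x y [(v', w - w')]"
      by (rule bess_append)
    also have "\<dots> \<le> ?N (v - v') * ?M w + ?N v' * ?M (w - w')"
      by (intro add_mono bess_tensor_le)
    also have "\<dots> \<le> ennreal \<delta> * ennreal B + ennreal A * ennreal \<delta>"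
      using v'(2,3) w'(2) A B by (intro add_mono mult_mono) auto
    also have "\<dots> = ennreal (\<delta> * (A + B))"
      using A(1) B(1) \<open>0 < \<delta>\<close> by (simp add: ennreal_mult[symmetric] ennreal_plus[symmetric] algebra_simps del: ennreal_plus)
    also have "\<dots> \<le> ennreal \<epsilon>"
      using A(1) B(1) assms by (intro ennreal_leI) (simp add: \<delta>_def field_simps)
    finally show "bess a b x y [(v - v', w), (v', w - w')] \<le> ennreal \<epsilon>" by simp
  qed
qed

lemma bess_approximation:
  assumes "0 < \<epsilon>"
  obtains u' us where "u' \<in> span (range basic)" "u - u' = (\<Sum>(v, w)\<leftarrow>us. tensor v w)"
    "bess a b x y us \<le> ennreal \<epsilon>"
proof -
  obtain ts where ts: "u = (\<Sum>(v, w)\<leftarrow>ts. tensor v w)" by (rule tensor_product_sum_list)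
  have "\<exists>u' us. u' \<in> span (range basic) \<and> u - u' = (\<Sum>(v, w)\<leftarrow>us. tensor v w) \<and> bess a b x y us \<le> ennreal \<epsilon>"
    using ts assms
  proof (induction ts arbitrary: u \<epsilon>)
    case Nil
    have "bess a b x y [] \<le> 0"
      unfolding bess_eq by (rule SUP_least) simp
    with Nil show ?case by (intro exI[of _ 0] exI[of _ "[]"]) (simp add: span_zero)
  next
    case (Cons t ts)
    obtain v w where t: "t = (v, w)" by fastforce
    have "0 < \<epsilon>/2" using Cons.prems by simp
    obtain u1 us1 where 1: "u1 \<in> span (range basic)" "tensor v w - u1 = (\<Sum>(v, w)\<leftarrow>us1. tensor v w)"
        "bess a b x y us1 \<le> ennreal (\<epsilon>/2)"
      by (rule bess_approximation_tensor[OF \<open>0 < \<epsilon>/2\<close>])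
    obtain u2 us2 where 2: "u2 \<in> span (range basic)"
        "(\<Sum>(v, w)\<leftarrow>ts. tensor v w) - u2 = (\<Sum>(v, w)\<leftarrow>us2. tensor v w)"
        "bess a b x y us2 \<le> ennreal (\<epsilon>/2)"
      using Cons.IH[OF refl \<open>0 < \<epsilon>/2\<close>] by blast
    have "bess a b x y (us1 @ us2) \<le> ennreal (\<epsilon>/2) + ennreal (\<epsilon>/2)"
      using bess_append[of us1 us2] add_mono[OF 1(3) 2(3)] by (rule order_trans)
    also have "\<dots> = ennreal \<epsilon>"
      using \<open>0 < \<epsilon>/2\<close> by (subst ennreal_plus[symmetric]) auto
    finally have "bess a b x y (us1 @ us2) \<le> ennreal \<epsilon>" .
    moreover have "u - (u1 + u2) = (\<Sum>(v, w)\<leftarrow>us1 @ us2. tensor v w)"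
      using Cons.prems(1) by (simp add: t 1(2)[symmetric] 2(2)[symmetric])
    ultimately show ?case using span_add[OF 1(1) 2(1)] by blast
  qed
  then show ?thesis using that by blast
qed

lemma coef_mem_wspace: "coef u \<in> wspace weights"
proof (rule P.wspace_closed)
  fix \<epsilon> :: real assume "0 < \<epsilon>"
  obtain u' us where u': "u' \<in> span (range basic)" "u - u' = (\<Sum>(v, w)\<leftarrow>us. tensor v w)"
      "bess a b x y us \<le> ennreal \<epsilon>"
    by (rule bess_approximation[OF \<open>0 < \<epsilon>\<close>])
  obtain H where "finite H" "\<And>p. p \<notin> H \<Longrightarrow> coef u' p = 0"
    by (rule span_basic_coef[OF u'(1)]) blast
  then have "coef u' \<in> wspace weights" by (rule P.wspace_finite_support)
  moreover have "wnorm weights (\<lambda>p. coef u p - coef u' p) \<le> ennreal \<epsilon>"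
    using wnorm_coef_le_bess[OF u'(2)] u'(3) by (simp add: coef_diff[abs_def])
  ultimately show "\<exists>e\<in>wspace weights. wnorm weights (\<lambda>p. coef u p - e p) \<le> ennreal \<epsilon>" by blast
qed

text \<open>The infimum over representations is the norm of the coefficient matrix: an almost optimal
  representation of \<open>u\<close> joins the basis expansion of an approximant \<open>u'\<close> to a cheap representation
  of \<open>u - u'\<close>.\<close>
lemma bess_crossnorm_eq: "bess_crossnorm a b x y u = wnorm_real weights (coef u)"
proof -
  let ?R = "{ts. u = (\<Sum>(v, w)\<leftarrow>ts. tensor v w)}"
  have "(INF ts\<in>?R. bess a b x y ts) = wnorm weights (coef u)"
  proof (rule antisym)
    show "wnorm weights (coef u) \<le> (INF ts\<in>?R. bess a b x y ts)"
      by (rule INF_greatest) (simp add: wnorm_coef_le_bess)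
    show "(INF ts\<in>?R. bess a b x y ts) \<le> wnorm weights (coef u)"
    proof (rule ennreal_le_epsilon)
      fix \<epsilon> :: real assume "0 < \<epsilon>"
      then have "0 < \<epsilon>/2" by simp
      obtain u' us where u': "u' \<in> span (range basic)" "u - u' = (\<Sum>(v, w)\<leftarrow>us. tensor v w)"
          "bess a b x y us \<le> ennreal (\<epsilon>/2)"
        by (rule bess_approximation[OF \<open>0 < \<epsilon>/2\<close>])
      obtain ts where ts: "u' = (\<Sum>(v, w)\<leftarrow>ts. tensor v w)" "bess a b x y ts \<le> wnorm weights (coef u')"
        by (rule bess_span_basic[OF u'(1)])
      have "wnorm weights (coef u') = wnorm weights (\<lambda>p. coef u p - coef (u - u') p)"
        by (simp add: coef_diff)
      also have "\<dots> \<le> wnorm weights (coef u) + wnorm weights (coef (u - u'))"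
        by (rule P.wnorm_diff)
      also have "\<dots> \<le> wnorm weights (coef u) + ennreal (\<epsilon>/2)"
        using wnorm_coef_le_bess[OF u'(2)] u'(3) by (intro add_left_mono) simp
      finally have u'_le: "wnorm weights (coef u') \<le> wnorm weights (coef u) + ennreal (\<epsilon>/2)" .
      have "u = (\<Sum>(v, w)\<leftarrow>ts @ us. tensor v w)"
        using ts(1) u'(2) by (simp add: algebra_simps)
      then have "(INF ts\<in>?R. bess a b x y ts) \<le> bess a b x y (ts @ us)"
        by (intro INF_lower) simp
      also have "\<dots> \<le> bess a b x y ts + bess a b x y us" by (rule bess_append)
      also have "\<dots> \<le> (wnorm weights (coef u) + ennreal (\<epsilon>/2)) + ennreal (\<epsilon>/2)"
        by (intro add_mono u'(3) order_trans[OF ts(2) u'_le])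
      also have "\<dots> = wnorm weights (coef u) + ennreal \<epsilon>"
        using \<open>0 < \<epsilon>\<close> by (simp add: add.assoc ennreal_plus[symmetric] del: ennreal_plus)
      finally show "(INF ts\<in>?R. bess a b x y ts) \<le> wnorm weights (coef u) + ennreal \<epsilon>" .
    qed
  qed
  then show ?thesis by (simp add: bess_crossnorm_def wnorm_real_def)
qed

lemma banach_lattice_bess_completion:
  "\<exists>leq. banach_lattice (norm_completion (bess_crossnorm a b x y)) leq"
proof (rule P.banach_lattice_norm_completion[of coef])
  fix H :: "(nat \<times> nat) set" and d :: "nat \<times> nat \<Rightarrow> real"
  assume H: "finite H" "\<And>p. p \<notin> H \<Longrightarrow> d p = 0"
  have "coef (\<Sum>q\<in>H. d q *\<^sub>R basic q) p = d p" for p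
    unfolding coef_sum coef_scale coef_basic using H by (simp add: if_distrib cong: if_cong)
  then show "\<exists>u. coef u = d" by blast
qed (simp_all add: coef_add coef_scale coef_mem_wspace bess_crossnorm_eq)

end

section \<open>The three Banach lattices\<close>

theorem proposition4:
  fixes a :: "nat \<Rightarrow> 'a::banach" and b :: "nat \<Rightarrow> 'a \<Rightarrow>\<^sub>L real"
    and x :: "nat \<Rightarrow> 'b::banach" and y :: "nat \<Rightarrow> 'b \<Rightarrow>\<^sub>L real"
  assumes "unconditional_schauder_basis a b"
    and "unconditional_schauder_basis x y"
  shows "(\<exists>leq. banach_lattice (renormed (bess_norm a b)) leq) \<and>
         (\<exists>leq. banach_lattice (renormed (bess_norm x y)) leq) \<and>
         (\<exists>leq. banach_lattice (norm_completion (bess_crossnorm a b x y)) leq)"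
proof -
  interpret schauder_basis_pair a b x y
    using assms by unfold_locales
  show ?thesis
    using E.banach_lattice_renormed F.banach_lattice_renormed banach_lattice_bess_completion by blast
qed

end
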